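(* Let $G$ be a finite connected, nonbipartite, $R$-thin graph on at least $3$ vertices that is prime with respect to the weak product. Suppose $G$ admits a proper coloring with $\chi(G)$ colors having a color class $C_1$ such that no nontrivial automorphism of $G$ fixes every vertex of $C_1$. Then $\chi_D(G^{\times n})\le \chi(G)+1$ for every $n\ge4$.
   Context: The weak (direct) product $G\times H$ has vertex set $V(G)\times V(H)$, with $(g_1,h_1)$ adjacent to $(g_2,h_2)$ iff $g_1g_2\in E(G)$ and $h_1h_2\in E(H)$; $G^{\times n}$ denotes the $n$-fold weak product of $G$ with itself. A graph is $R$-thin if no two distinct vertices have the same open neighborhood. $K_1^s$ denotes a single vertex with a loop. A graph $G$ is prime (with respect to the weak product) if it is nontrivial and $G\cong G_1\times G_2$ implies $G_1\cong K_1^s$ or $G_2\cong K_1^s$. A coloring is distinguishing if the only graph automorphism mapping every color class onto itself is the identity; $\chi_D(G)$ is the minimum number of colors of a proper distinguishing coloring of $G$. *)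

theory Defs
  imports "HOL-Library.FuncSet"
begin

text \<open>A graph is a vertex set V with a symmetric adjacency relation E living on V.
  Loops (E v v) are allowed, as needed for the weak product and for K_1^s.\<close>

definition graph :: "'a set \<Rightarrow> ('a \<Rightarrow> 'a \<Rightarrow> bool) \<Rightarrow> bool" where
  "graph V E \<longleftrightarrow> (\<forall>x y. E x y \<longrightarrow> x \<in> V \<and> y \<in> V) \<and> (\<forall>x y. E x y \<longrightarrow> E y x)"

definition loopless :: "'a set \<Rightarrow> ('a \<Rightarrow> 'a \<Rightarrow> bool) \<Rightarrow> bool" where
  "loopless V E \<longleftrightarrow> (\<forall>v\<in>V. \<not> E v v)"

definition connected_graph :: "'a set \<Rightarrow> ('a \<Rightarrow> 'a \<Rightarrow> bool) \<Rightarrow> bool" where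
  "connected_graph V E \<longleftrightarrow> (\<forall>x\<in>V. \<forall>y\<in>V. E\<^sup>*\<^sup>* x y)"

definition open_nbhd :: "('a \<Rightarrow> 'a \<Rightarrow> bool) \<Rightarrow> 'a \<Rightarrow> 'a set" where
  "open_nbhd E v = {u. E v u}"

definition R_thin :: "'a set \<Rightarrow> ('a \<Rightarrow> 'a \<Rightarrow> bool) \<Rightarrow> bool" where
  "R_thin V E \<longleftrightarrow> (\<forall>x\<in>V. \<forall>y\<in>V. open_nbhd E x = open_nbhd E y \<longrightarrow> x = y)"

definition proper_coloring :: "'a set \<Rightarrow> ('a \<Rightarrow> 'a \<Rightarrow> bool) \<Rightarrow> ('a \<Rightarrow> nat) \<Rightarrow> nat \<Rightarrow> bool" where
  "proper_coloring V E c k \<longleftrightarrow> (\<forall>v\<in>V. c v < k) \<and> (\<forall>x\<in>V. \<forall>y\<in>V. E x y \<longrightarrow> c x \<noteq> c y)"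

definition chromatic_number :: "'a set \<Rightarrow> ('a \<Rightarrow> 'a \<Rightarrow> bool) \<Rightarrow> nat" where
  "chromatic_number V E = (LEAST k. \<exists>c. proper_coloring V E c k)"

definition bipartite :: "'a set \<Rightarrow> ('a \<Rightarrow> 'a \<Rightarrow> bool) \<Rightarrow> bool" where
  "bipartite V E \<longleftrightarrow> (\<exists>c. proper_coloring V E c 2)"

definition graph_iso :: "('a \<Rightarrow> 'b) \<Rightarrow> 'a set \<Rightarrow> ('a \<Rightarrow> 'a \<Rightarrow> bool) \<Rightarrow> 'b set \<Rightarrow> ('b \<Rightarrow> 'b \<Rightarrow> bool) \<Rightarrow> bool" where
  "graph_iso f V E V' E' \<longleftrightarrow> bij_betw f V V' \<and> (\<forall>x\<in>V. \<forall>y\<in>V. E x y \<longleftrightarrow> E' (f x) (f y))"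

definition isomorphic :: "'a set \<Rightarrow> ('a \<Rightarrow> 'a \<Rightarrow> bool) \<Rightarrow> 'b set \<Rightarrow> ('b \<Rightarrow> 'b \<Rightarrow> bool) \<Rightarrow> bool" where
  "isomorphic V E V' E' \<longleftrightarrow> (\<exists>f. graph_iso f V E V' E')"

definition automorphism :: "'a set \<Rightarrow> ('a \<Rightarrow> 'a \<Rightarrow> bool) \<Rightarrow> ('a \<Rightarrow> 'a) \<Rightarrow> bool" where
  "automorphism V E f \<longleftrightarrow> graph_iso f V E V E"

definition wprod_edges :: "('a \<Rightarrow> 'a \<Rightarrow> bool) \<Rightarrow> ('b \<Rightarrow> 'b \<Rightarrow> bool) \<Rightarrow> ('a \<times> 'b) \<Rightarrow> ('a \<times> 'b) \<Rightarrow> bool" where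
  "wprod_edges E1 E2 = (\<lambda>(g1, h1) (g2, h2). E1 g1 g2 \<and> E2 h1 h2)"

definition K1s_V :: "nat set" where "K1s_V = {0}"
definition K1s_E :: "nat \<Rightarrow> nat \<Rightarrow> bool" where "K1s_E x y \<longleftrightarrow> x = 0 \<and> y = 0"

text \<open>Primality w.r.t. the weak product. Factors range over graphs with vertices in nat;
  since any factor of a finite graph is finite, this loses no generality.\<close>
definition nontrivial_graph :: "'a set \<Rightarrow> ('a \<Rightarrow> 'a \<Rightarrow> bool) \<Rightarrow> bool" where
  "nontrivial_graph V E \<longleftrightarrow> \<not> isomorphic V E K1s_V K1s_E"

definition prime_graph :: "'a set \<Rightarrow> ('a \<Rightarrow> 'a \<Rightarrow> bool) \<Rightarrow> bool" where
  "prime_graph V E \<longleftrightarrow> nontrivial_graph V E \<and>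
     (\<forall>(V1::nat set) E1 (V2::nat set) E2. graph V1 E1 \<and> graph V2 E2 \<and>
        isomorphic V E (V1 \<times> V2) (wprod_edges E1 E2) \<longrightarrow>
        isomorphic V1 E1 K1s_V K1s_E \<or> isomorphic V2 E2 K1s_V K1s_E)"

definition wpow_V :: "'a set \<Rightarrow> nat \<Rightarrow> (nat \<Rightarrow> 'a) set" where
  "wpow_V V n = PiE {..<n} (\<lambda>_. V)"

definition wpow_E :: "('a \<Rightarrow> 'a \<Rightarrow> bool) \<Rightarrow> nat \<Rightarrow> (nat \<Rightarrow> 'a) \<Rightarrow> (nat \<Rightarrow> 'a) \<Rightarrow> bool" where
  "wpow_E E n x y \<longleftrightarrow> x \<in> PiE {..<n} (\<lambda>_. UNIV) \<and> y \<in> PiE {..<n} (\<lambda>_. UNIV) \<and> (\<forall>i<n. E (x i) (y i))"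

definition distinguishing :: "'a set \<Rightarrow> ('a \<Rightarrow> 'a \<Rightarrow> bool) \<Rightarrow> ('a \<Rightarrow> nat) \<Rightarrow> bool" where
  "distinguishing V E c \<longleftrightarrow>
     (\<forall>f. automorphism V E f \<and> (\<forall>v\<in>V. c (f v) = c v) \<longrightarrow> (\<forall>v\<in>V. f v = v))"

definition distinguishing_chromatic_number :: "'a set \<Rightarrow> ('a \<Rightarrow> 'a \<Rightarrow> bool) \<Rightarrow> nat" where
  "distinguishing_chromatic_number V E =
     (LEAST k. \<exists>c. proper_coloring V E c k \<and> distinguishing V E c)"

end

theory Submission
  imports Defs Complex_Main
begin

text \<open>
  On \<open>G\<^sup>n\<close> put the weight \<open>ln \<bar>N x\<bar> + ln \<bar>N y\<bar> - 2 ln \<bar>N x \<inter> N y\<bar>\<close> on pairs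
  of vertices with a common neighbor. Neighborhoods in a weak product are products, so the weight is a sum over the coordinates; it is
  invariant under automorphisms, and it vanishes only for \<open>x = y\<close> by thinness. The induced path
  metric inherits these properties, and it is finite since \<open>G\<close> is connected and not bipartite. For an
  additive metric the coordinate layers are gated, and a gated set is a box with respect to every
  additive coordinate system, in particular the one transported by an automorphism. Primality of
  \<open>G\<close> then forces each automorphism of \<open>G\<^sup>n\<close> to permute coordinates and to act by an automorphism
  of \<open>G\<close> in each of them.

  Color \<open>x\<close> by the color of its last coordinate and recolor a subset of \<open>C\<^sub>1 \<times> G\<^sup>n\<^sup>-\<^sup>1\<close>
  whose fibres over \<open>C\<^sub>1\<close> have distinct cardinalities, one of them being a
  set without nontrivial coordinatewise symmetries. Such sets exist in dimension at least three: they
  are built one coordinate at a time from slices of distinct cardinality.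
\<close>

subsection \<open>An additive metric invariant under automorphisms\<close>

text \<open>The logarithm of card N(x) times card N(y), divided by the square of card (N(x) \<inter>
  N(y)); it measures how far two neighborhoods are from coinciding.\<close>

definition nbhd_weight :: "('a \<Rightarrow> 'a \<Rightarrow> bool) \<Rightarrow> 'a \<Rightarrow> 'a \<Rightarrow> real" where
  "nbhd_weight E x y = ln (real (card (open_nbhd E x))) + ln (real (card (open_nbhd E y)))
     - 2 * ln (real (card (open_nbhd E x \<inter> open_nbhd E y)))"

text \<open>The length is an index of the relation, so chains can be concatenated, transported and
  projected by rule induction. The common neighbor demanded for each step keeps the last logarithm
  in the weight meaningful.\<close>

inductive nbhd_chain :: "('a \<Rightarrow> 'a \<Rightarrow> bool) \<Rightarrow> 'a \<Rightarrow> 'a \<Rightarrow> real \<Rightarrow> bool" for E where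
  nbhd_chain_refl: "nbhd_chain E x x 0"
| nbhd_chain_step: "nbhd_chain E x y r \<Longrightarrow> open_nbhd E y \<inter> open_nbhd E z \<noteq> {} \<Longrightarrow>
    nbhd_chain E x z (r + nbhd_weight E y z)"

text \<open>The infimum carries information only for pairs joined by some chain;
  \<open>ex_chain\<close> provides one for any two vertices of a connected nonbipartite
  graph.\<close>

definition nbhd_dist :: "('a \<Rightarrow> 'a \<Rightarrow> bool) \<Rightarrow> 'a \<Rightarrow> 'a \<Rightarrow> real" where
  "nbhd_dist E x y = Inf {r. nbhd_chain E x y r}"

lemma nbhd_weight_commute: "nbhd_weight E x y = nbhd_weight E y x"
  by (simp add: nbhd_weight_def Int_commute)

lemma nbhd_chain_trans:
  assumes "nbhd_chain E y z s" "nbhd_chain E x y r"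
  shows "nbhd_chain E x z (r + s)"
  using assms
proof (induction rule: nbhd_chain.induct)
  case (nbhd_chain_step y w s z)
  then have "nbhd_chain E x z (r + s + nbhd_weight E w z)"
    by (intro nbhd_chain.nbhd_chain_step) auto
  then show ?case by (simp add: algebra_simps)
qed auto

lemma nbhd_chain_sym: "nbhd_chain E x y r \<Longrightarrow> nbhd_chain E y x r"
proof (induction rule: nbhd_chain.induct)
  case (nbhd_chain_refl x)
  show ?case by (rule nbhd_chain.nbhd_chain_refl)
next
  case (nbhd_chain_step x y r z)
  have "nbhd_chain E z y (0 + nbhd_weight E z y)"
    using nbhd_chain_step by (intro nbhd_chain.intros) auto
  with nbhd_chain_trans[OF nbhd_chain_step.IH this] show ?case
    by (simp add: nbhd_weight_commute algebra_simps)
qed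

lemma finite_open_nbhd: "graph V E \<Longrightarrow> finite V \<Longrightarrow> finite (open_nbhd E x)"
  by (rule finite_subset[of _ V]) (auto simp: graph_def open_nbhd_def)

lemma open_nbhd_subset: "graph V E \<Longrightarrow> open_nbhd E x \<subseteq> V"
  by (auto simp: graph_def open_nbhd_def)

text \<open>The intersection is at most as large as either neighborhood, so the weight is a sum of
  two nonnegative differences of logarithms. If both vanish, the intersection equals each
  neighborhood.\<close>

lemma
  assumes "graph V E" "finite V" "open_nbhd E x \<inter> open_nbhd E y \<noteq> {}"
  shows nbhd_weight_nonneg: "nbhd_weight E x y \<ge> 0"
    and nbhd_weight_eq_0D: "nbhd_weight E x y = 0 \<Longrightarrow> open_nbhd E x = open_nbhd E y"
proof -
  let ?A = "open_nbhd E x" and ?B = "open_nbhd E y"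
  have fin: "finite ?A" "finite ?B" using finite_open_nbhd[OF assms(1,2)] by auto
  have pos: "card (?A \<inter> ?B) > 0" using assms(3) fin by (simp add: card_gt_0_iff)
  have le: "card (?A \<inter> ?B) \<le> card ?A" "card (?A \<inter> ?B) \<le> card ?B"
    using fin by (auto intro: card_mono)
  have lnle: "ln (real (card (?A \<inter> ?B))) \<le> ln (real (card ?A))"
             "ln (real (card (?A \<inter> ?B))) \<le> ln (real (card ?B))"
    using pos le by auto
  then show "nbhd_weight E x y \<ge> 0" by (simp add: nbhd_weight_def)
  assume "nbhd_weight E x y = 0"
  with lnle have "ln (real (card (?A \<inter> ?B))) = ln (real (card ?A))"
             "ln (real (card (?A \<inter> ?B))) = ln (real (card ?B))"
    by (auto simp: nbhd_weight_def)
  then have "card (?A \<inter> ?B) = card ?A" "card (?A \<inter> ?B) = card ?B"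
    using pos le by auto
  then have "?A \<inter> ?B = ?A" "?A \<inter> ?B = ?B"
    using fin by (metis card_subset_eq inf_le1, metis card_subset_eq inf_le2)
  then show "?A = ?B" by simp
qed

lemma nbhd_chain_nonneg:
  assumes "graph V E" "finite V" "nbhd_chain E x y r"
  shows "r \<ge> 0"
  using assms(3) by induction (auto simp: nbhd_weight_nonneg[OF assms(1,2)])

lemma nbhd_dist_le:
  assumes "graph V E" "finite V" "nbhd_chain E x y r"
  shows "nbhd_dist E x y \<le> r"
  unfolding nbhd_dist_def
proof (rule cInf_lower)
  show "bdd_below {r. nbhd_chain E x y r}"
    by (rule bdd_belowI[of _ 0]) (simp add: nbhd_chain_nonneg[OF assms(1,2)])
qed (simp add: assms(3))

text \<open>The infimum is never shown to be attained, so upper bounds on distances work with chains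
  that are optimal up to \<epsilon>.\<close>

lemma nbhd_chain_near_dist:
  assumes "\<exists>r. nbhd_chain E x y r" "\<epsilon> > 0"
  shows "\<exists>r. nbhd_chain E x y r \<and> r < nbhd_dist E x y + \<epsilon>"
proof -
  have "Inf {r. nbhd_chain E x y r} < nbhd_dist E x y + \<epsilon>"
    using assms(2) by (simp add: nbhd_dist_def)
  moreover have "{r. nbhd_chain E x y r} \<noteq> {}" using assms(1) by simp
  ultimately obtain r where "r \<in> {r. nbhd_chain E x y r}" "r < nbhd_dist E x y + \<epsilon>"
    using cInf_lessD by meson
  then show ?thesis by auto
qed

lemma nbhd_dist_commute: "nbhd_dist E x y = nbhd_dist E y x"
proof -
  have "nbhd_chain E x y = nbhd_chain E y x" by (intro ext iffI) (rule nbhd_chain_sym, assumption)+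
  then show ?thesis by (simp add: nbhd_dist_def)
qed

section \<open>Walks of even length in connected nonbipartite graphs\<close>

lemma even_walk_or_odd_walk:
  assumes "E\<^sup>*\<^sup>* x y"
  shows "(E OO E)\<^sup>*\<^sup>* x y \<or> ((E OO E)\<^sup>*\<^sup>* OO E) x y"
  using assms
proof induction
  case (step y z)
  from step.IH show ?case
  proof
    assume "((E OO E)\<^sup>*\<^sup>* OO E) x y"
    then obtain u where "(E OO E)\<^sup>*\<^sup>* x u" "E u y" by auto
    with step.hyps have "(E OO E)\<^sup>*\<^sup>* x z"
      by (meson relcompp.relcompI rtranclp.rtrancl_into_rtrancl)
    then show ?thesis ..
  next
    assume "(E OO E)\<^sup>*\<^sup>* x y"
    then show ?thesis using step.hyps by blast
  qed
qed simp

text \<open>If some \<open>y\<close> has no even walk from \<open>x\<close>, then coloring each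
  vertex by whether an even walk from \<open>x\<close> reaches it is a proper 2-coloring. Steps of
  \<open>E OO E\<close> are exactly the moves between vertices with a common neighbor, which is what
  chains are made of.\<close>

lemma even_walk_if_not_bipartite:
  assumes "graph V E" "connected_graph V E" "\<not> bipartite V E" "x \<in> V" "y \<in> V"
  shows "(E OO E)\<^sup>*\<^sup>* x y"
proof (rule ccontr)
  assume n: "\<not> (E OO E)\<^sup>*\<^sup>* x y"
  let ?e = "(E OO E)\<^sup>*\<^sup>*"
  have sym: "E a b \<Longrightarrow> E b a" for a b using assms(1) by (auto simp: graph_def)
  have conn: "E\<^sup>*\<^sup>* a b" if "a \<in> V" "b \<in> V" for a b
    using assms(2) that by (auto simp: connected_graph_def)
  have step: "(E OO E)\<^sup>*\<^sup>* x u \<Longrightarrow> E u v \<Longrightarrow> E v w \<Longrightarrow> ?e x w" for u v w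
    by (meson relcompp.relcompI rtranclp.rtrancl_into_rtrancl)
  \<comment> \<open>An edge joining two vertices that are both reached evenly would give an even
    walk to \<open>y\<close>: if \<open>y\<close> is at odd distance along a walk from
    \<open>w\<close>, entering that walk from \<open>v\<close> changes its parity.\<close>
  have even: False if e: "?e x v" "?e x w" "E v w" "v \<in> V" "w \<in> V" for v w
  proof -
    from even_walk_or_odd_walk[OF conn[OF \<open>w \<in> V\<close> \<open>y \<in> V\<close>]] show False
    proof
      assume "?e w y"
      with e(2) n show False by (meson rtranclp_trans)
    next
      assume "(?e OO E) w y"
      then obtain u where u: "?e w u" "E u y" by auto
      \<comment> \<open>An edge attached to the start of an even walk is slid along the walk to its
        end, two steps at a time.\<close>
      have odd: "?e a b \<Longrightarrow> E c a \<Longrightarrow> \<exists>d. E b d \<and> ?e c d" for a b c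
      proof (induction rule: rtranclp_induct)
        case base
        then show ?case using sym by auto
      next
        case (step b' b'')
        then obtain d where d: "E b' d" "?e c d" by auto
        from step.hyps obtain m where m: "E b' m" "E m b''" by auto
        then have "(E OO E) d m" using d sym by auto
        with d have "?e c m" by (meson rtranclp.rtrancl_into_rtrancl)
        then show ?case using m sym by auto
      qed
      from odd[OF u(1) e(3)] obtain d where d: "E u d" "?e v d" by auto
      have "(E OO E) d y" using d u sym by auto
      with d have "?e v y" by (meson rtranclp.rtrancl_into_rtrancl)
      with e(1) n show False by (meson rtranclp_trans)
    qed
  qed
  have "proper_coloring V E (\<lambda>v. if ?e x v then 0 else 1) 2"
    unfolding proper_coloring_def
  proof (intro conjI ballI impI)
    fix v w assume vw: "v \<in> V" "w \<in> V" "E v w"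
    have "\<not> (\<not> ?e x v \<and> \<not> ?e x w)"
    proof
      assume h: "\<not> ?e x v \<and> \<not> ?e x w"
      with even_walk_or_odd_walk[OF conn[OF \<open>x \<in> V\<close> \<open>v \<in> V\<close>]] obtain u
        where "?e x u" "E u v" by auto
      with step vw h show False by blast
    qed
    with even vw show "(if ?e x v then 0 else 1) \<noteq> (if ?e x w then 0 else (1::nat))" by auto
  qed auto
  with assms(3) show False by (auto simp: bipartite_def)
qed

section \<open>The path metric of one thin graph\<close>

locale thin_graph =
  fixes V :: "'a set" and E :: "'a \<Rightarrow> 'a \<Rightarrow> bool"
  assumes graph: "graph V E" and finite_V: "finite V"
    and connected: "connected_graph V E" and not_bipartite: "\<not> bipartite V E"
    and thin: "R_thin V E"
begin

abbreviation d :: "'a \<Rightarrow> 'a \<Rightarrow> real" where "d \<equiv> nbhd_dist E"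

lemma edge_sym: "E x y \<Longrightarrow> E y x"
  and edge_V: "E x y \<Longrightarrow> x \<in> V" "E x y \<Longrightarrow> y \<in> V"
  using graph by (auto simp: graph_def)

text \<open>By connectedness an isolated vertex would be the whole graph, and a single vertex
  without a loop is bipartite.\<close>

lemma ex_neighbor:
  assumes "x \<in> V" shows "\<exists>y. E x y"
proof (rule ccontr)
  assume n: "\<nexists>y. E x y"
  have "y = x" if "y \<in> V" for y
  proof -
    have "E\<^sup>*\<^sup>* x y" using connected that assms by (auto simp: connected_graph_def)
    then show ?thesis using n by (auto elim: converse_rtranclpE)
  qed
  then have "proper_coloring V E (\<lambda>_. 0) 2"
    using n by (auto simp: proper_coloring_def)
  then show False using not_bipartite by (auto simp: bipartite_def)
qed

lemma ex_chain:
  assumes "x \<in> V" "y \<in> V" shows "\<exists>r. nbhd_chain E x y r"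
  using even_walk_if_not_bipartite[OF graph connected not_bipartite assms]
proof induction
  case base
  show ?case by (blast intro: nbhd_chain_refl)
next
  case (step y z)
  then obtain r where "nbhd_chain E x y r" by auto
  moreover have "open_nbhd E y \<inter> open_nbhd E z \<noteq> {}"
    using step.hyps edge_sym by (auto simp: open_nbhd_def)
  ultimately show ?case by (blast intro: nbhd_chain_step)
qed

lemmas d_le = nbhd_dist_le[OF graph finite_V]

lemma d_nonneg: "x \<in> V \<Longrightarrow> y \<in> V \<Longrightarrow> d x y \<ge> 0"
  unfolding nbhd_dist_def
  by (rule cInf_greatest) (simp_all add: ex_chain nbhd_chain_nonneg[OF graph finite_V])

lemma d_refl [simp]: "x \<in> V \<Longrightarrow> d x x = 0"
  using d_le[OF nbhd_chain_refl, of x] d_nonneg[of x x] by simp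

lemma d_triangle:
  assumes "x \<in> V" "y \<in> V" "z \<in> V" shows "d x z \<le> d x y + d y z"
proof (rule field_le_epsilon)
  fix e :: real assume "e > 0"
  then have "e / 2 > 0" by simp
  from nbhd_chain_near_dist[OF ex_chain[OF assms(1,2)] this]
       nbhd_chain_near_dist[OF ex_chain[OF assms(2,3)] this]
  obtain r s where rs: "nbhd_chain E x y r" "r < d x y + e/2" "nbhd_chain E y z s" "s < d y z + e/2"
    by auto
  then show "d x z \<le> d x y + d y z + e"
    using d_le[OF nbhd_chain_trans[OF rs(3,1)]] by simp
qed

text \<open>An infimum of positive lengths could still be zero. Here only finitely many weights
  occur between distinct vertices, all positive by thinness, so their minimum bounds every chain
  with distinct ends from below.\<close>

lemma d_eq_zero:
  assumes "x \<in> V" "y \<in> V" "d x y = 0" shows "x = y"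
proof (rule ccontr)
  assume ne: "x \<noteq> y"
  define W where "W = {nbhd_weight E u v | u v. u \<in> V \<and> v \<in> V \<and> u \<noteq> v \<and>
     open_nbhd E u \<inter> open_nbhd E v \<noteq> {}}"
  have "W \<subseteq> (\<lambda>(u, v). nbhd_weight E u v) ` (V \<times> V)" by (auto simp: W_def)
  then have finW: "finite W" using finite_V finite_subset by blast
  have posW: "w > 0" if w: "w \<in> W" for w
  proof -
    obtain u v where uv: "w = nbhd_weight E u v" "u \<in> V" "v \<in> V" "u \<noteq> v"
      "open_nbhd E u \<inter> open_nbhd E v \<noteq> {}" using w unfolding W_def by blast
    have "open_nbhd E u \<noteq> open_nbhd E v" using thin uv by (auto simp: R_thin_def)
    then show ?thesis using nbhd_weight_nonneg[OF graph finite_V uv(5)]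
        nbhd_weight_eq_0D[OF graph finite_V uv(5)] uv(1) by linarith
  qed
  \<comment> \<open>Inserting 1 keeps the minimum defined and positive even if \<open>W\<close> is
    empty.\<close>
  define m where "m = Min (insert 1 W)"
  have m: "m > 0" "\<And>w. w \<in> W \<Longrightarrow> m \<le> w" using finW posW by (auto simp: m_def)
  have "x \<noteq> y \<longrightarrow> m \<le> r" if "nbhd_chain E x y r" "x \<in> V" for x y r
    using that
  proof induction
    case (nbhd_chain_step x y r z)
    show ?case
    proof
      assume "x \<noteq> z"
      note w = nbhd_weight_nonneg[OF graph finite_V nbhd_chain_step.hyps(2)]
      show "m \<le> r + nbhd_weight E y z"
      proof (cases "y = z")
        case True
        then show ?thesis using nbhd_chain_step \<open>x \<noteq> z\<close> w by auto
      next
        case False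
        have "y \<in> V" "z \<in> V"
          using nbhd_chain_step.hyps(2) edge_V by (auto simp: open_nbhd_def)
        then have "nbhd_weight E y z \<in> W" using False nbhd_chain_step.hyps(2) by (auto simp: W_def)
        then show ?thesis
          using m nbhd_chain_nonneg[OF graph finite_V nbhd_chain_step.hyps(1)] by force
      qed
    qed
  qed auto
  then have "m \<le> d x y"
    unfolding nbhd_dist_def using ex_chain[OF assms(1,2)] ne assms(1)
    by (intro cInf_greatest) auto
  with m assms show False by simp
qed

end

section \<open>Weak powers as boxes, and invariance of the metric under automorphisms\<close>

lemma graph_wpow: "graph V E \<Longrightarrow> graph (wpow_V V n) (wpow_E E n)"
  by (auto simp: graph_def wpow_V_def wpow_E_def PiE_iff)

lemma open_nbhd_wpow:
  "x \<in> wpow_V V n \<Longrightarrow> open_nbhd (wpow_E E n) x = (\<Pi>\<^sub>E i\<in>{..<n}. open_nbhd E (x i))"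
  by (auto simp: open_nbhd_def wpow_V_def wpow_E_def PiE_iff extensional_def)

lemma wpow_upd: "x \<in> wpow_V V n \<Longrightarrow> i < n \<Longrightarrow> a \<in> V \<Longrightarrow> x(i := a) \<in> wpow_V V n"
  by (auto simp: wpow_V_def PiE_iff extensional_def)

lemma wpow_nth: "x \<in> wpow_V V n \<Longrightarrow> i < n \<Longrightarrow> x i \<in> V"
  by (auto simp: wpow_V_def)

lemma wpow_ext: "x \<in> wpow_V V n \<Longrightarrow> y \<in> wpow_V V n \<Longrightarrow> (\<And>i. i < n \<Longrightarrow> x i = y i) \<Longrightarrow> x = y"
  unfolding wpow_V_def by (rule PiE_ext) auto

lemma nbhd_chain_automorphism:
  assumes "graph V E" "automorphism V E f" "nbhd_chain E x y r" "x \<in> V"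
  shows "nbhd_chain E (f x) (f y) r"
proof -
  have bij: "bij_betw f V V" and iso: "\<And>a b. a \<in> V \<Longrightarrow> b \<in> V \<Longrightarrow> E (f a) (f b) = E a b"
    using assms(2) by (auto simp: automorphism_def graph_iso_def)
  have inj: "inj_on f V" using bij by (simp add: bij_betw_def)
  have N: "open_nbhd E (f a) = f ` open_nbhd E a" if a: "a \<in> V" for a
  proof
    show "f ` open_nbhd E a \<subseteq> open_nbhd E (f a)"
      using open_nbhd_subset[OF assms(1), of a] iso a by (auto simp: open_nbhd_def)
    show "open_nbhd E (f a) \<subseteq> f ` open_nbhd E a"
    proof
      fix b assume b: "b \<in> open_nbhd E (f a)"
      then have "b \<in> V" using open_nbhd_subset[OF assms(1)] by auto
      then obtain c where "c \<in> V" "b = f c" using bij by (auto simp: bij_betw_def)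
      then show "b \<in> f ` open_nbhd E a" using b iso a by (auto simp: open_nbhd_def)
    qed
  qed
  have NN: "open_nbhd E (f a) \<inter> open_nbhd E (f b) = f ` (open_nbhd E a \<inter> open_nbhd E b)"
    if "a \<in> V" "b \<in> V" for a b
    using N[OF that(1)] N[OF that(2)] inj_on_image_Int[OF inj] open_nbhd_subset[OF assms(1)] by metis
  have c: "card (f ` S) = card S" if "S \<subseteq> V" for S
    using that inj by (meson card_image inj_on_subset)
  have w: "nbhd_weight E (f a) (f b) = nbhd_weight E a b" if ab: "a \<in> V" "b \<in> V" for a b
  proof -
    have "open_nbhd E a \<inter> open_nbhd E b \<subseteq> V" using open_nbhd_subset[OF assms(1)] by blast
    then show ?thesis
      unfolding nbhd_weight_def NN[OF ab] unfolding N[OF ab(1)] N[OF ab(2)]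
      by (simp add: c open_nbhd_subset[OF assms(1)])
  qed
  from assms(3,4) show ?thesis
  proof induction
    case (nbhd_chain_refl x)
    show ?case by (rule nbhd_chain.nbhd_chain_refl)
  next
    case (nbhd_chain_step x y r z)
    have V: "y \<in> V" "z \<in> V"
      using nbhd_chain_step.hyps(2) assms(1) by (auto simp: open_nbhd_def graph_def)
    have "nbhd_chain E (f x) (f z) (r + nbhd_weight E (f y) (f z))"
      using nbhd_chain_step V by (intro nbhd_chain.nbhd_chain_step) (auto simp: NN)
    then show ?case by (simp add: w V)
  qed
qed

lemma automorphism_inv_into:
  assumes "automorphism V E f" shows "automorphism V E (inv_into V f)"
proof -
  have bij: "bij_betw f V V" and iso: "\<And>a b. a \<in> V \<Longrightarrow> b \<in> V \<Longrightarrow> E (f a) (f b) = E a b"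
    using assms by (auto simp: automorphism_def graph_iso_def)
  have "E (inv_into V f x) (inv_into V f y) = E x y" if "x \<in> V" "y \<in> V" for x y
    using iso[of "inv_into V f x" "inv_into V f y"] that bij
    by (metis bij_betw_def bij_betw_inv_into_right inv_into_into)
  then show ?thesis using bij_betw_inv_into[OF bij] by (auto simp: automorphism_def graph_iso_def)
qed

lemma nbhd_dist_automorphism:
  assumes "graph V E" "automorphism V E f" "x \<in> V" "y \<in> V"
  shows "nbhd_dist E (f x) (f y) = nbhd_dist E x y"
proof -
  have bij: "bij_betw f V V" using assms(2) by (auto simp: automorphism_def graph_iso_def)
  have "nbhd_chain E (f x) (f y) r \<longleftrightarrow> nbhd_chain E x y r" for r
  proof
    assume "nbhd_chain E (f x) (f y) r"
    from nbhd_chain_automorphism[OF assms(1) automorphism_inv_into[OF assms(2)] this]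
    show "nbhd_chain E x y r"
      using bij assms(3,4) by (auto simp: bij_betw_inv_into_left[OF bij] bij_betw_def)
  qed (rule nbhd_chain_automorphism[OF assms(1,2) _ assms(3)])
  then show ?thesis by (simp add: nbhd_dist_def)
qed

section \<open>Additivity of the metric over the coordinates\<close>

context thin_graph
begin

lemma finite_wpow: "finite (wpow_V V n)"
  unfolding wpow_V_def by (rule finite_PiE) (auto simp: finite_V)

lemmas graph_wpow' = graph_wpow[OF graph]

text \<open>Neighborhoods in the power and their intersections are boxes, whose cardinalities
  multiply. The hypothesis of common neighbors makes every factor positive, so the logarithm of the
  product is the sum of the logarithms.\<close>

lemma nbhd_weight_wpow:
  assumes "x \<in> wpow_V V n" "y \<in> wpow_V V n"
    and "\<And>i. i < n \<Longrightarrow> open_nbhd E (x i) \<inter> open_nbhd E (y i) \<noteq> {}"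
  shows "nbhd_weight (wpow_E E n) x y = (\<Sum>i<n. nbhd_weight E (x i) (y i))"
proof -
  have fin: "finite (open_nbhd E a)" for a by (rule finite_open_nbhd[OF graph finite_V])
  have ln_card: "ln (real (card (\<Pi>\<^sub>E i\<in>{..<n}. A i))) = (\<Sum>i<n. ln (real (card (A i))))"
    if "\<And>i. i < n \<Longrightarrow> finite (A i) \<and> A i \<noteq> {}" for A :: "nat \<Rightarrow> 'a set"
  proof -
    have "real (card (\<Pi>\<^sub>E i\<in>{..<n}. A i)) = (\<Prod>i<n. real (card (A i)))"
      by (simp add: card_PiE)
    also have "ln \<dots> = (\<Sum>i<n. ln (real (card (A i))))"
      using that by (intro ln_prod) (auto simp: card_gt_0_iff)
    finally show ?thesis .
  qed
  have "open_nbhd E (x i) \<noteq> {}" "open_nbhd E (y i) \<noteq> {}" if "i < n" for i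
    using assms(3)[OF that] by auto
  then show ?thesis
    using assms(3) unfolding nbhd_weight_def open_nbhd_wpow[OF assms(1)] open_nbhd_wpow[OF assms(2)] PiE_Int
    by (subst (1 2 3) ln_card) (auto simp: fin sum_subtractf sum.distrib sum_distrib_left)
qed

text \<open>A chain in the power projects to a chain in every coordinate; this gives the lower bound
  for the metric of the power.\<close>

lemma nbhd_chain_wpowD:
  assumes "nbhd_chain (wpow_E E n) x y r" "x \<in> wpow_V V n"
  shows "\<exists>\<rho>. (\<forall>i<n. nbhd_chain E (x i) (y i) (\<rho> i)) \<and> r = (\<Sum>i<n. \<rho> i)"
  using assms
proof induction
  case (nbhd_chain_refl x)
  have "\<forall>i<n. nbhd_chain E (x i) (x i) 0" by (simp add: nbhd_chain.nbhd_chain_refl)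
  then show ?case by (intro exI[of _ "\<lambda>_. 0"]) auto
next
  case (nbhd_chain_step x y r z)
  then obtain \<rho> where \<rho>: "\<forall>i<n. nbhd_chain E (x i) (y i) (\<rho> i)" "r = (\<Sum>i<n. \<rho> i)" by blast
  have V: "y \<in> wpow_V V n" "z \<in> wpow_V V n"
    using nbhd_chain_step.hyps(2) graph_wpow' unfolding graph_def open_nbhd_def by blast+
  have ne: "open_nbhd E (y i) \<inter> open_nbhd E (z i) \<noteq> {}" if "i < n" for i
    using nbhd_chain_step.hyps(2) that
    unfolding open_nbhd_wpow[OF V(1)] open_nbhd_wpow[OF V(2)] PiE_Int by (auto simp: PiE_eq_empty_iff)
  show ?case
    by (rule exI[of _ "\<lambda>i. \<rho> i + nbhd_weight E (y i) (z i)"])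
      (use \<rho> ne in \<open>auto simp: nbhd_weight_wpow[OF V ne] sum.distrib intro: nbhd_chain.nbhd_chain_step\<close>)
qed

text \<open>A chain of the factor is copied into one layer. The resting coordinates have weight 0,
  and they have a common neighbor with themselves because no vertex is isolated.\<close>

lemma nbhd_chain_upd:
  assumes "nbhd_chain E a b r" "a \<in> V" "x \<in> wpow_V V n" "i < n"
  shows "nbhd_chain (wpow_E E n) (x(i := a)) (x(i := b)) r"
  using assms(1,2)
proof induction
  case (nbhd_chain_refl a)
  show ?case by (rule nbhd_chain.nbhd_chain_refl)
next
  case (nbhd_chain_step a b r c)
  have V: "b \<in> V" "c \<in> V" using nbhd_chain_step.hyps(2) edge_V by (auto simp: open_nbhd_def)
  have bc: "x(i := b) \<in> wpow_V V n" "x(i := c) \<in> wpow_V V n"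
    using V assms by (auto intro: wpow_upd)
  have nonempty: "open_nbhd E u \<noteq> {}" if "u \<in> V" for u
    using ex_neighbor[OF that] by (auto simp: open_nbhd_def)
  have ne: "open_nbhd E ((x(i := b)) k) \<inter> open_nbhd E ((x(i := c)) k) \<noteq> {}" if "k < n" for k
    using that nbhd_chain_step.hyps(2) wpow_nth[OF assms(3)] nonempty by auto
  have zero: "nbhd_weight E u u = 0" for u by (simp add: nbhd_weight_def)
  have "nbhd_weight (wpow_E E n) (x(i := b)) (x(i := c))
      = (\<Sum>k<n. nbhd_weight E ((x(i := b)) k) ((x(i := c)) k))"
    by (rule nbhd_weight_wpow[OF bc ne])
  also have "\<dots> = nbhd_weight E b c"
    by (subst sum.remove[of _ i]) (auto simp: assms zero intro!: sum.neutral)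
  finally have "nbhd_weight (wpow_E E n) (x(i := b)) (x(i := c)) = nbhd_weight E b c" .
  moreover have "open_nbhd (wpow_E E n) (x(i := b)) \<inter> open_nbhd (wpow_E E n) (x(i := c)) \<noteq> {}"
    unfolding open_nbhd_wpow[OF bc(1)] open_nbhd_wpow[OF bc(2)] PiE_Int
    using ne by (auto simp: PiE_eq_empty_iff)
  ultimately show ?case
    using nbhd_chain.nbhd_chain_step[OF nbhd_chain_step.IH[OF nbhd_chain_step.prems]] by metis
qed

lemma nbhd_chain_wpowI:
  assumes "x \<in> wpow_V V n" "y \<in> wpow_V V n" "\<And>i. i < n \<Longrightarrow> nbhd_chain E (x i) (y i) (\<rho> i)"
  shows "nbhd_chain (wpow_E E n) x y (\<Sum>i<n. \<rho> i)"
proof -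
  \<comment> \<open>The hybrids take the first \<open>k\<close> coordinates from \<open>y\<close>
    and the others from \<open>x\<close>, so consecutive ones differ in one coordinate only.\<close>
  define z where "z k = (\<lambda>i. if i < k then y i else x i)" for k
  have "k \<le> n \<Longrightarrow> z k \<in> wpow_V V n \<and> nbhd_chain (wpow_E E n) x (z k) (\<Sum>i<k. \<rho> i)" for k
  proof (induction k)
    case 0
    then show ?case using assms(1) by (simp add: z_def nbhd_chain_refl)
  next
    case (Suc k)
    then have IH: "z k \<in> wpow_V V n" "nbhd_chain (wpow_E E n) x (z k) (\<Sum>i<k. \<rho> i)" and k: "k < n" by auto
    have zS: "z (Suc k) = (z k)(k := y k)" and zk: "(z k)(k := x k) = z k"
      by (auto simp: z_def less_Suc_eq fun_eq_iff)
    have "nbhd_chain (wpow_E E n) (z k) (z (Suc k)) (\<rho> k)"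
      using nbhd_chain_upd[OF assms(3)[OF k] wpow_nth[OF assms(1) k] IH(1) k] by (simp add: zS zk)
    from nbhd_chain_trans[OF this IH(2)] show ?case
      using wpow_upd[OF IH(1) k wpow_nth[OF assms(2) k]] zS by (metis sum.lessThan_Suc)
  qed
  from this[of n] have "nbhd_chain (wpow_E E n) x (z n) (\<Sum>i<n. \<rho> i)" "z n \<in> wpow_V V n" by auto
  moreover have "z n = y" by (rule wpow_ext[OF \<open>z n \<in> _\<close> assms(2)]) (simp add: z_def)
  ultimately show ?thesis by simp
qed

lemma nbhd_dist_wpow:
  assumes "x \<in> wpow_V V n" "y \<in> wpow_V V n"
  shows "nbhd_dist (wpow_E E n) x y = (\<Sum>i<n. d (x i) (y i))"
proof (rule antisym)
  have xV: "x i \<in> V" "y i \<in> V" if "i < n" for i using wpow_nth that assms by auto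
  show "nbhd_dist (wpow_E E n) x y \<le> (\<Sum>i<n. d (x i) (y i))"
  proof (rule field_le_epsilon)
    fix e :: real assume "e > 0"
    \<comment> \<open>The slack is shared among the coordinates; dividing by \<open>n + 1\<close>
      also covers \<open>n = 0\<close>.\<close>
    then have e': "e / (real n + 1) > 0" by simp
    have "\<forall>i\<in>{..<n}. \<exists>r. nbhd_chain E (x i) (y i) r \<and> r < d (x i) (y i) + e / (real n + 1)"
      using nbhd_chain_near_dist[OF ex_chain[OF xV] e'] by auto
    then obtain \<rho> where \<rho>: "\<And>i. i < n \<Longrightarrow> nbhd_chain E (x i) (y i) (\<rho> i)"
      "\<And>i. i < n \<Longrightarrow> \<rho> i < d (x i) (y i) + e / (real n + 1)" by (metis lessThan_iff)
    have "nbhd_dist (wpow_E E n) x y \<le> (\<Sum>i<n. \<rho> i)"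
      by (rule nbhd_dist_le[OF graph_wpow' finite_wpow nbhd_chain_wpowI[OF assms \<rho>(1)]])
    also have "\<dots> \<le> (\<Sum>i<n. d (x i) (y i) + e / (real n + 1))"
      using \<rho>(2) by (intro sum_mono) (auto intro: less_imp_le)
    also have "\<dots> = (\<Sum>i<n. d (x i) (y i)) + real n * (e / (real n + 1))"
      by (simp add: sum.distrib)
    also have "real n * (e / (real n + 1)) \<le> e" using \<open>e > 0\<close> by (simp add: field_simps)
    finally show "nbhd_dist (wpow_E E n) x y \<le> (\<Sum>i<n. d (x i) (y i)) + e" by simp
  qed
  have "\<forall>i. \<exists>r. i < n \<longrightarrow> nbhd_chain E (x i) (y i) r" using ex_chain xV by blast
  then have "\<exists>\<rho>. \<forall>i<n. nbhd_chain E (x i) (y i) (\<rho> i)" by (rule choice)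
  then have "\<exists>r. nbhd_chain (wpow_E E n) x y r" using nbhd_chain_wpowI[OF assms] by blast
  moreover have "(\<Sum>i<n. d (x i) (y i)) \<le> r" if r: "nbhd_chain (wpow_E E n) x y r" for r
  proof -
    obtain \<rho> where \<rho>: "\<forall>i<n. nbhd_chain E (x i) (y i) (\<rho> i)" "r = (\<Sum>i<n. \<rho> i)"
      using nbhd_chain_wpowD[OF r assms(1)] by auto
    then show ?thesis by (auto intro!: sum_mono d_le)
  qed
  ultimately show "(\<Sum>i<n. d (x i) (y i)) \<le> nbhd_dist (wpow_E E n) x y"
    unfolding nbhd_dist_def[of "wpow_E E n"] by (intro cInf_greatest) auto
qed

end

subsection \<open>Automorphisms of powers of a prime graph\<close>

text \<open>The maps \<open>p\<close> and \<open>q\<close> act as two coordinates on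
  \<open>V\<close>: \<open>inj\<close> and \<open>mix\<close> make the pair a bijection onto the
  product of the images, and \<open>edge\<close> says that adjacency is decided in each coordinate
  separately. So the graph is a weak product of its two quotients, and primality makes one of them a
  single vertex.\<close>

lemma prime_graph_no_split:
  assumes gr: "graph V E" and fin: "finite V" and prime: "prime_graph V E"
    and inj: "\<And>a b. a \<in> V \<Longrightarrow> b \<in> V \<Longrightarrow> p a = p b \<Longrightarrow> q a = q b \<Longrightarrow> a = b"
    and mix: "\<And>a b. a \<in> V \<Longrightarrow> b \<in> V \<Longrightarrow> \<exists>c\<in>V. p c = p a \<and> q c = q b"
    and edge: "\<And>a b a1 b1 a2 b2. a \<in> V \<Longrightarrow> b \<in> V \<Longrightarrow> E a1 b1 \<Longrightarrow> E a2 b2 \<Longrightarrow>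
       p a1 = p a \<Longrightarrow> p b1 = p b \<Longrightarrow> q a2 = q a \<Longrightarrow> q b2 = q b \<Longrightarrow> E a b"
  shows "(\<forall>a\<in>V. \<forall>b\<in>V. p a = p b) \<or> (\<forall>a\<in>V. \<forall>b\<in>V. q a = q b)"
proof -
  \<comment> \<open>The values of \<open>p\<close> and \<open>q\<close> are numbered because
    \<open>prime_graph\<close> speaks only of factors on natural numbers.\<close>
  obtain e1 :: "_ \<Rightarrow> nat" where e1: "inj_on e1 (p ` V)"
    using finite_imp_inj_to_nat_seg[of "p ` V"] fin by auto
  obtain e2 :: "_ \<Rightarrow> nat" where e2: "inj_on e2 (q ` V)"
    using finite_imp_inj_to_nat_seg[of "q ` V"] fin by auto
  define P where "P a = e1 (p a)" for a
  define Q where "Q a = e2 (q a)" for a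
  have P: "P a = P b \<longleftrightarrow> p a = p b" if "a \<in> V" "b \<in> V" for a b
    using e1 that by (auto simp: P_def inj_on_def)
  have Q: "Q a = Q b \<longleftrightarrow> q a = q b" if "a \<in> V" "b \<in> V" for a b
    using e2 that by (auto simp: Q_def inj_on_def)
  define E1 where "E1 u v \<longleftrightarrow> (\<exists>a b. E a b \<and> u = P a \<and> v = P b)" for u v
  define E2 where "E2 u v \<longleftrightarrow> (\<exists>a b. E a b \<and> u = Q a \<and> v = Q b)" for u v
  have EV: "E a b \<Longrightarrow> a \<in> V \<and> b \<in> V \<and> E b a" for a b using gr by (auto simp: graph_def)
  have "graph (P ` V) E1" "graph (Q ` V) E2"
    unfolding graph_def E1_def E2_def using EV by blast+
  moreover have "graph_iso (\<lambda>a. (P a, Q a)) V E (P ` V \<times> Q ` V) (wprod_edges E1 E2)"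
    unfolding graph_iso_def
  proof (intro conjI ballI)
    show "bij_betw (\<lambda>a. (P a, Q a)) V (P ` V \<times> Q ` V)"
      unfolding bij_betw_def
    proof
      show "inj_on (\<lambda>a. (P a, Q a)) V" using inj P Q by (auto simp: inj_on_def)
      have "(P a, Q b) \<in> (\<lambda>a. (P a, Q a)) ` V" if ab: "a \<in> V" "b \<in> V" for a b
      proof -
        obtain c where "c \<in> V" "p c = p a" "q c = q b" using mix[OF ab] by auto
        then show ?thesis by (intro image_eqI[of _ _ c]) (auto simp: P_def Q_def)
      qed
      then show "(\<lambda>a. (P a, Q a)) ` V = P ` V \<times> Q ` V" by auto
    qed
    fix a b assume ab: "a \<in> V" "b \<in> V"
    have "E a b" if e: "E1 (P a) (P b)" "E2 (Q a) (Q b)"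
    proof -
      obtain a1 b1 where 1: "E a1 b1" "P a = P a1" "P b = P b1" using e(1) by (auto simp: E1_def)
      obtain a2 b2 where 2: "E a2 b2" "Q a = Q a2" "Q b = Q b2" using e(2) by (auto simp: E2_def)
      show ?thesis
        using edge[OF ab 1(1) 2(1)] 1 2 EV[OF 1(1)] EV[OF 2(1)] P Q ab by metis
    qed
    then show "E a b = wprod_edges E1 E2 (P a, Q a) (P b, Q b)"
      by (auto simp: wprod_edges_def E1_def E2_def)
  qed
  ultimately have "isomorphic (P ` V) E1 K1s_V K1s_E \<or> isomorphic (Q ` V) E2 K1s_V K1s_E"
    using prime unfolding prime_graph_def isomorphic_def by blast
  then have "card (P ` V) = 1 \<or> card (Q ` V) = 1"
    unfolding isomorphic_def graph_iso_def K1s_V_def by (auto dest: bij_betw_same_card)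
  then show ?thesis
  proof
    assume "card (P ` V) = 1"
    then obtain u where "P ` V = {u}" by (rule card_1_singletonE)
    then have "p a = p b" if "a \<in> V" "b \<in> V" for a b
      using P[OF that] that by (metis imageI singletonD)
    then show ?thesis by blast
  next
    assume "card (Q ` V) = 1"
    then obtain u where "Q ` V = {u}" by (rule card_1_singletonE)
    then have "q a = q b" if "a \<in> V" "b \<in> V" for a b
      using Q[OF that] that by (metis imageI singletonD)
    then show ?thesis by blast
  qed
qed

section \<open>Gated layers and the coordinate system transported by an automorphism\<close>

context thin_graph
begin

text \<open>The share of the coordinates \<open>J\<close> in the metric; for
  \<open>J = {..<n}\<close> it is the metric of the power on its vertices, by
  \<open>nbhd_dist_wpow\<close>.\<close>

definition dsum :: "nat set \<Rightarrow> (nat \<Rightarrow> 'a) \<Rightarrow> (nat \<Rightarrow> 'a) \<Rightarrow> real" where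
  "dsum J x y = (\<Sum>k\<in>J. d (x k) (y k))"

lemma dsum_commute: "dsum J x y = dsum J y x"
  by (simp add: dsum_def nbhd_dist_commute)

lemma dsum_cong:
  assumes "\<And>k. k \<in> J \<Longrightarrow> x k = x' k" "\<And>k. k \<in> J \<Longrightarrow> y k = y' k"
  shows "dsum J x y = dsum J x' y'"
  unfolding dsum_def by (rule sum.cong) (use assms in auto)

lemma dsum_nonneg:
  "J \<subseteq> {..<n} \<Longrightarrow> x \<in> wpow_V V n \<Longrightarrow> y \<in> wpow_V V n \<Longrightarrow> dsum J x y \<ge> 0"
  unfolding dsum_def by (auto intro!: sum_nonneg d_nonneg simp: wpow_nth)

lemma dsum_self: "J \<subseteq> {..<n} \<Longrightarrow> x \<in> wpow_V V n \<Longrightarrow> dsum J x x = 0"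
  unfolding dsum_def by (auto intro!: sum.neutral simp: wpow_nth)

lemma dsum_eq_0D:
  assumes "J \<subseteq> {..<n}" "x \<in> wpow_V V n" "y \<in> wpow_V V n" "dsum J x y = 0" "k \<in> J"
  shows "x k = y k"
proof -
  have "finite J" using assms(1) finite_subset by blast
  moreover have V: "x i \<in> V" "y i \<in> V" if "i \<in> J" for i
    using that assms wpow_nth by blast+
  ultimately have "d (x k) (y k) = 0"
    using assms(4,5) sum_nonneg_eq_0_iff[of J "\<lambda>k. d (x k) (y k)"]
    by (auto simp: dsum_def d_nonneg)
  then show ?thesis using d_eq_zero V assms(5) by blast
qed

lemma dsum_triangle:
  assumes "J \<subseteq> {..<n}" "x \<in> wpow_V V n" "y \<in> wpow_V V n" "z \<in> wpow_V V n"
  shows "dsum J x z \<le> dsum J x y + dsum J y z"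
  unfolding dsum_def sum.distrib[symmetric]
  by (rule sum_mono, rule d_triangle) (use assms wpow_nth in blast)+

lemma dsum_split: "J \<subseteq> {..<n} \<Longrightarrow> dsum {..<n} x y = dsum J x y + dsum ({..<n} - J) x y"
  unfolding dsum_def by (subst sum.subset_diff[of J]) (auto simp: add.commute)

text \<open>The vertex \<open>z(i := x i)\<close> is the gate of \<open>x\<close> in the layer
  through \<open>z\<close> in direction \<open>i\<close>: coordinate \<open>i\<close> contributes
  only to the second summand, the other coordinates only to the first.\<close>

lemma layer_gated:
  assumes "x \<in> wpow_V V n" "z \<in> wpow_V V n" "i < n" "a \<in> V"
  shows "dsum {..<n} x (z(i := a)) = dsum {..<n} x (z(i := x i)) + dsum {..<n} (z(i := x i)) (z(i := a))"
proof -
  have i: "{i} \<subseteq> {..<n}" using assms by auto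
  have xi: "x i \<in> V" using assms wpow_nth by blast
  have "dsum ({..<n} - {i}) (z(i := x i)) (z(i := a)) = dsum ({..<n} - {i}) z z"
    by (rule dsum_cong) auto
  also have "\<dots> = 0" by (rule dsum_self[OF _ assms(2)]) auto
  finally have 1: "dsum ({..<n} - {i}) (z(i := x i)) (z(i := a)) = 0" .
  have 2: "dsum ({..<n} - {i}) x (z(i := a)) = dsum ({..<n} - {i}) x (z(i := x i))"
    by (rule dsum_cong) auto
  show ?thesis
    unfolding dsum_split[OF i] 1 2 using xi by (simp add: dsum_def)
qed

context
  fixes n :: nat and f :: "(nat \<Rightarrow> 'a) \<Rightarrow> nat \<Rightarrow> 'a"
  assumes aut: "automorphism (wpow_V V n) (wpow_E E n) f"
begin

lemma aut_bij: "bij_betw f (wpow_V V n) (wpow_V V n)"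
  and aut_edge: "\<And>x y. x \<in> wpow_V V n \<Longrightarrow> y \<in> wpow_V V n \<Longrightarrow> wpow_E E n (f x) (f y) = wpow_E E n x y"
  using aut by (auto simp: automorphism_def graph_iso_def)

lemma aut_in: "x \<in> wpow_V V n \<Longrightarrow> f x \<in> wpow_V V n"
  using aut_bij by (auto simp: bij_betw_def)

lemma aut_surj: "y \<in> wpow_V V n \<Longrightarrow> \<exists>x\<in>wpow_V V n. f x = y"
  using aut_bij by (metis bij_betw_def imageE)

lemma aut_inj: "x \<in> wpow_V V n \<Longrightarrow> y \<in> wpow_V V n \<Longrightarrow> f x = f y \<Longrightarrow> x = y"
  using aut_bij by (auto simp: bij_betw_def inj_on_def)

lemma dsum_automorphism:
  assumes "x \<in> wpow_V V n" "y \<in> wpow_V V n"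
  shows "dsum {..<n} (f x) (f y) = dsum {..<n} x y"
  using nbhd_dist_automorphism[OF graph_wpow' aut assms]
  by (simp add: nbhd_dist_wpow assms aut_in dsum_def)

text \<open>The coordinates of \<open>f x\<close> form a second additive coordinate system on the
  power. By surjectivity of \<open>f\<close>, its values can be combined freely from two
  vertices.\<close>

lemma aut_mix:
  assumes "x \<in> wpow_V V n" "y \<in> wpow_V V n"
  obtains w where "w \<in> wpow_V V n" "\<And>k. k \<in> J \<Longrightarrow> k < n \<Longrightarrow> f w k = f x k" "\<And>k. k \<notin> J \<Longrightarrow> k < n \<Longrightarrow> f w k = f y k"
proof -
  have "(\<lambda>k. if k \<in> J then f x k else f y k) \<in> wpow_V V n"
    using aut_in[OF assms(1)] aut_in[OF assms(2)] by (auto simp: wpow_V_def PiE_iff extensional_def)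
  from aut_surj[OF this] show ?thesis using that by auto
qed

text \<open>A vertex mixed from two layer vertices in the transported coordinates lies metrically
  between them. Both distances from it to the ends pass through its gate in the layer, so by the
  triangle inequality it coincides with that gate.\<close>

lemma layer_mix_closed:
  assumes J: "J \<subseteq> {..<n}" and z: "z \<in> wpow_V V n" and i: "i < n" and ab: "a \<in> V" "b \<in> V"
    and w: "w \<in> wpow_V V n" "\<And>k. k \<in> J \<Longrightarrow> f w k = f (z(i := a)) k"
      "\<And>k. k \<in> {..<n} - J \<Longrightarrow> f w k = f (z(i := b)) k"
  shows "w = z(i := w i)"
proof -
  let ?D = "dsum {..<n}" and ?u = "z(i := a)" and ?v = "z(i := b)" and ?r = "z(i := w i)"
  let ?J' = "{..<n} - J"
  have wi: "w i \<in> V" using w i wpow_nth by blast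
  have u: "?u \<in> wpow_V V n" "?v \<in> wpow_V V n" "?r \<in> wpow_V V n"
    using z i ab wi by (simp_all add: wpow_upd)
  have fs: "f ?u \<in> wpow_V V n" "f ?v \<in> wpow_V V n" "f w \<in> wpow_V V n" using aut_in u w by auto
  \<comment> \<open>The images of \<open>w\<close> and \<open>?u\<close> differ only outside
    \<open>J\<close>, those of \<open>w\<close> and \<open>?v\<close> only inside \<open>J\<close>;
    the two distances therefore add up to that between \<open>?u\<close> and
    \<open>?v\<close>.\<close>
  have "?D (f ?u) (f w) = dsum ?J' (f ?u) (f ?v)"
    unfolding dsum_split[OF J]
    using dsum_cong[of J "f ?u" "f ?u" "f w" "f ?u"] dsum_cong[of ?J' "f ?u" "f ?u" "f w" "f ?v"]
      w dsum_self[OF J fs(1)] by auto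
  moreover have "?D (f w) (f ?v) = dsum J (f ?u) (f ?v)"
    unfolding dsum_split[OF J]
    using dsum_cong[of J "f w" "f ?u" "f ?v" "f ?v"] dsum_cong[of ?J' "f w" "f ?v" "f ?v" "f ?v"]
      w dsum_self[of ?J', OF _ fs(2)] by auto
  ultimately have "?D (f ?u) (f ?v) = ?D (f ?u) (f w) + ?D (f w) (f ?v)"
    using dsum_split[OF J] by simp
  then have 1: "?D ?u ?v = ?D ?u w + ?D w ?v" by (simp add: dsum_automorphism u w)
  have 2: "?D w ?u = ?D w ?r + ?D ?r ?u" "?D w ?v = ?D w ?r + ?D ?r ?v"
    using layer_gated[OF w(1) z i] ab by auto
  have 3: "?D ?u ?v \<le> ?D ?u ?r + ?D ?r ?v" by (rule dsum_triangle) (use u in auto)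
  have "?D w ?r \<ge> 0" by (rule dsum_nonneg) (use u w in auto)
  with 1 2 3 have "?D w ?r = 0" using dsum_commute[of _ ?u] by auto
  then show ?thesis
    by (intro wpow_ext[OF w(1) u(3)]) (rule dsum_eq_0D[OF _ w(1) u(3)], auto)
qed

text \<open>The gate property survives when the metric is restricted to a set \<open>J\<close> of
  transported coordinates. Hence the gates of two vertices that agree on \<open>J\<close> are at
  distance zero on \<open>J\<close>.\<close>

lemma gate_respects_coordinates:
  assumes J: "J \<subseteq> {..<n}" and z: "z \<in> wpow_V V n" and i: "i < n"
    and x: "x \<in> wpow_V V n" "x' \<in> wpow_V V n" and eq: "\<And>k. k \<in> J \<Longrightarrow> f x k = f x' k"
    and k: "k \<in> J"
  shows "f (z(i := x i)) k = f (z(i := x' i)) k"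
proof -
  let ?D = "dsum {..<n}" and ?J' = "{..<n} - J"
  have key: "dsum J (f x) (f (z(i := x' i))) =
      dsum J (f x) (f (z(i := x i))) + dsum J (f (z(i := x i))) (f (z(i := x' i)))"
    if x: "x \<in> wpow_V V n" "x' \<in> wpow_V V n" for x x'
  proof -
    let ?u = "z(i := x i)" and ?v = "z(i := x' i)"
    have xi: "x i \<in> V" "x' i \<in> V" using x i wpow_nth by auto
    have u: "?u \<in> wpow_V V n" "?v \<in> wpow_V V n" using z i xi by (simp_all add: wpow_upd)
    \<comment> \<open>This vertex agrees with the gate of \<open>x'\<close> on \<open>J\<close> and
      with the gate of \<open>x\<close> elsewhere. It stays in the layer, so the gate equation
      applies to it, and only the share of \<open>J\<close> separates it from the gate of
      \<open>x\<close>.\<close>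
    obtain w where w: "w \<in> wpow_V V n" "\<And>k. k \<in> J \<Longrightarrow> k < n \<Longrightarrow> f w k = f ?v k"
      "\<And>k. k \<notin> J \<Longrightarrow> k < n \<Longrightarrow> f w k = f ?u k" using aut_mix[OF u(2,1), of J] by blast
    have w': "\<And>k. k \<in> J \<Longrightarrow> f w k = f ?v k" "\<And>k. k \<in> ?J' \<Longrightarrow> f w k = f ?u k" using w J by auto
    have "w = z(i := w i)" by (rule layer_mix_closed[OF J z i xi(2,1) w(1) w'])
    then have "?D x w = ?D x ?u + ?D ?u w" using layer_gated[OF x(1) z i, of "w i"] w(1) i wpow_nth by auto
    then have "?D (f x) (f w) = ?D (f x) (f ?u) + ?D (f ?u) (f w)" by (simp add: dsum_automorphism x u w)
    moreover have "dsum J (f y) (f w) = dsum J (f y) (f ?v)" for y by (rule dsum_cong) (use w' in auto)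
    moreover have "dsum ?J' (f y) (f w) = dsum ?J' (f y) (f ?u)" for y by (rule dsum_cong) (use w' in auto)
    moreover have "dsum ?J' (f ?u) (f ?u) = 0" by (rule dsum_self[OF _ aut_in[OF u(1)]]) auto
    ultimately show ?thesis unfolding dsum_split[OF J] by simp
  qed
  let ?u = "z(i := x i)" and ?v = "z(i := x' i)"
  have u: "?u \<in> wpow_V V n" "?v \<in> wpow_V V n" using z i x by (simp_all add: wpow_upd wpow_nth)
  have xx: "dsum J (f x) y = dsum J (f x') y" for y by (rule dsum_cong) (use eq in auto)
  \<comment> \<open>Adding \<open>key\<close> for the pair and for the swapped pair leaves twice
    this distance equal to 0.\<close>
  have "dsum J (f ?u) (f ?v) = 0"
    using key[OF x] key[OF x(2,1)] xx dsum_commute[of J "f ?u" "f ?v"] by simp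
  from dsum_eq_0D[OF J aut_in[OF u(1)] aut_in[OF u(2)] this k] show ?thesis .
qed

lemma wpow_edge_in: "wpow_E E n x y \<Longrightarrow> x \<in> wpow_V V n \<and> y \<in> wpow_V V n"
  using graph_wpow' by (auto simp: graph_def)

lemma ex_wpow_edge:
  assumes "z \<in> wpow_V V n" "i < n" "E a b"
  shows "\<exists>y. wpow_E E n (z(i := a)) y \<and> y i = b"
proof -
  have "\<forall>k\<in>{..<n}. \<exists>v. E (z k) v" using ex_neighbor wpow_nth[OF assms(1)] by auto
  then obtain g where g: "\<And>k. k < n \<Longrightarrow> E (z k) (g k)" by (metis lessThan_iff)
  have "wpow_E E n (z(i := a)) (\<lambda>k\<in>{..<n}. if k = i then b else g k)"
    using assms g by (auto simp: wpow_E_def wpow_V_def PiE_iff extensional_def)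
  then show ?thesis using assms(2) by (intro exI[of _ "\<lambda>k\<in>{..<n}. if k = i then b else g k"]) auto
qed

text \<open>A layer is a copy of the prime graph, and the images of its vertices split into
  coordinate \<open>j\<close> and the rest. By \<open>prime_graph_no_split\<close> one part is
  constant on the layer; gates carry this from one layer to all parallel ones.\<close>

lemma single_coordinate_dependence:
  assumes prime: "prime_graph V E" and i: "i < n" and j: "j < n"
  shows "(\<forall>z\<in>wpow_V V n. \<forall>a\<in>V. \<forall>b\<in>V. f (z(i := a)) j = f (z(i := b)) j) \<or>
    (\<forall>k. k < n \<and> k \<noteq> j \<longrightarrow> (\<forall>z\<in>wpow_V V n. \<forall>a\<in>V. \<forall>b\<in>V. f (z(i := a)) k = f (z(i := b)) k))"
proof (cases "wpow_V V n = {}")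
  case False
  then obtain z where z: "z \<in> wpow_V V n" by auto
  note gate = gate_respects_coordinates[OF _ _ i]
  have zu: "a \<in> V \<Longrightarrow> z(i := a) \<in> wpow_V V n" for a using z i by (simp add: wpow_upd)
  define p where "p a = f (z(i := a)) j" for a
  define q where "q a = (\<lambda>k\<in>{..<n} - {j}. f (z(i := a)) k)" for a
  have qk: "q a = q b \<longleftrightarrow> (\<forall>k\<in>{..<n} - {j}. f (z(i := a)) k = f (z(i := b)) k)" for a b
    unfolding q_def restrict_def fun_eq_iff by auto
  have J: "{j} \<subseteq> {..<n}" "{..<n} - {j} \<subseteq> {..<n}" using j by auto
  have inj: "a = b" if ab: "a \<in> V" "b \<in> V" and pq: "p a = p b" "q a = q b" for a b
  proof -
    have "f (z(i := a)) = f (z(i := b))"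
    proof (rule wpow_ext[OF aut_in[OF zu[OF ab(1)]] aut_in[OF zu[OF ab(2)]]])
      fix k assume "k < n"
      then show "f (z(i := a)) k = f (z(i := b)) k"
        using pq qk by (cases "k = j") (auto simp: p_def)
    qed
    then have "z(i := a) = z(i := b)" using aut_inj zu ab by blast
    then show ?thesis by (metis fun_upd_same)
  qed
  have const: "(\<forall>a\<in>V. \<forall>b\<in>V. p a = p b) \<or> (\<forall>a\<in>V. \<forall>b\<in>V. q a = q b)"
  proof (rule prime_graph_no_split[OF graph finite_V prime])
    fix a b assume ab: "a \<in> V" "b \<in> V"
    show "a = b" if "p a = p b" "q a = q b" using inj ab that by blast
    obtain w where w: "w \<in> wpow_V V n" "\<And>k. k \<in> {j} \<Longrightarrow> k < n \<Longrightarrow> f w k = f (z(i := a)) k"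
      "\<And>k. k \<notin> {j} \<Longrightarrow> k < n \<Longrightarrow> f w k = f (z(i := b)) k" using aut_mix[OF zu zu] ab by metis
    have "w = z(i := w i)" by (rule layer_mix_closed[OF J(1) z i ab w(1)]) (use w j in auto)
    then have "f (z(i := w i)) = f w" by simp
    then have "p (w i) = p a" "q (w i) = q b" unfolding qk using w j by (auto simp: p_def)
    then show "\<exists>c\<in>V. p c = p a \<and> q c = q b" using w i wpow_nth by blast
  next
    fix a b a1 b1 a2 b2
    assume ab: "a \<in> V" "b \<in> V" and e: "E a1 b1" "E a2 b2"
      and pq: "p a1 = p a" "p b1 = p b" "q a2 = q a" "q b2 = q b"
    \<comment> \<open>Edges of the factor are lifted to edges of the power, where \<open>f\<close>
      is known to preserve adjacency. The upper ends may leave the layer, hence the return through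
      gates in \<open>sel\<close>.\<close>
    obtain y1 where y1: "wpow_E E n (z(i := a1)) y1" "y1 i = b1" using ex_wpow_edge[OF z i e(1)] by auto
    obtain y2 where y2: "wpow_E E n (z(i := a2)) y2" "y2 i = b2" using ex_wpow_edge[OF z i e(2)] by auto
    let ?x1 = "z(i := a1)" and ?x2 = "z(i := a2)"
    have in_W: "?x1 \<in> wpow_V V n" "?x2 \<in> wpow_V V n" "y1 \<in> wpow_V V n" "y2 \<in> wpow_V V n"
      using wpow_edge_in[OF y1(1)] wpow_edge_in[OF y2(1)] by auto
    \<comment> \<open>A vertex mixed from \<open>u\<close> and \<open>v\<close> has a gate whose
      \<open>p\<close> part comes from \<open>u\<close> and whose \<open>q\<close> part comes from
      \<open>v\<close>; by \<open>inj\<close> this fixes its coordinate \<open>i\<close>.\<close>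
    have sel: "w i = c" if w: "w \<in> wpow_V V n" "\<And>k. k \<in> {j} \<Longrightarrow> k < n \<Longrightarrow> f w k = f u k"
      "\<And>k. k \<notin> {j} \<Longrightarrow> k < n \<Longrightarrow> f w k = f v k" and u: "u \<in> wpow_V V n" "v \<in> wpow_V V n"
      and c: "c \<in> V" "p (u i) = p c" "q (v i) = q c" for w u v c
    proof (rule inj)
      show "w i \<in> V" using w i wpow_nth by auto
      have "f (z(i := w i)) j = f (z(i := u i)) j"
        by (rule gate[OF J(1) z w(1) u(1)]) (use w j in auto)
      then show "p (w i) = p c" using c by (simp add: p_def)
      have "f (z(i := w i)) k = f (z(i := v i)) k" if "k \<in> {..<n} - {j}" for k
        by (rule gate[OF J(2) z w(1) u(2) _ that]) (use w in auto)
      then have "q (w i) = q (v i)" unfolding qk by auto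
      then show "q (w i) = q c" using c by simp
    qed (rule c)
    \<comment> \<open>Mixing the starts and the ends of the two image edges in the same way yields
      an edge again, since adjacency is coordinatewise; pulled back, its coordinate \<open>i\<close>
      gives the edge from \<open>a\<close> to \<open>b\<close>.\<close>
    obtain w where w: "w \<in> wpow_V V n" "\<And>k. k \<in> {j} \<Longrightarrow> k < n \<Longrightarrow> f w k = f ?x1 k"
      "\<And>k. k \<notin> {j} \<Longrightarrow> k < n \<Longrightarrow> f w k = f ?x2 k" using aut_mix[OF in_W(1,2)] by metis
    obtain v where v: "v \<in> wpow_V V n" "\<And>k. k \<in> {j} \<Longrightarrow> k < n \<Longrightarrow> f v k = f y1 k"
      "\<And>k. k \<notin> {j} \<Longrightarrow> k < n \<Longrightarrow> f v k = f y2 k" using aut_mix[OF in_W(3,4)] by metis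
    have wi: "w i = a" by (rule sel[OF w in_W(1,2) ab(1)]) (use pq in auto)
    have vi: "v i = b" by (rule sel[OF v in_W(3,4) ab(2)]) (use pq y1 y2 in auto)
    have "wpow_E E n (f ?x1) (f y1)" "wpow_E E n (f ?x2) (f y2)" using aut_edge in_W y1 y2 by auto
    then have "E (f w k) (f v k)" if "k < n" for k
      using that w v by (cases "k = j") (auto simp: wpow_E_def)
    then have "wpow_E E n (f w) (f v)"
      using aut_in[OF w(1)] aut_in[OF v(1)] by (auto simp: wpow_E_def wpow_V_def PiE_iff)
    then have "wpow_E E n w v" using aut_edge w v by auto
    then show "E a b" using wi vi i by (auto simp: wpow_E_def)
  qed
  \<comment> \<open>The gate of \<open>z(i := a)\<close> in the layer through \<open>z'\<close> is
    \<open>z'(i := a)\<close>, so an agreement in coordinate \<open>k\<close> passes to the parallel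
    layer.\<close>
  have ext: "f (z'(i := a)) k = f (z'(i := b)) k"
    if "z' \<in> wpow_V V n" "a \<in> V" "b \<in> V" "k < n" "f (z(i := a)) k = f (z(i := b)) k" for z' a b k
    using gate[of "{k}" z' "z(i := a)" "z(i := b)" k] that zu by simp
  from const show ?thesis
  proof
    assume "\<forall>a\<in>V. \<forall>b\<in>V. p a = p b"
    then show ?thesis using ext j unfolding p_def by blast
  next
    assume "\<forall>a\<in>V. \<forall>b\<in>V. q a = q b"
    then show ?thesis using ext unfolding qk by blast
  qed
qed auto

lemma independent_of_coordinates:
  assumes "\<And>i z a b. i < n \<Longrightarrow> i \<notin> A \<Longrightarrow> z \<in> wpow_V V n \<Longrightarrow> a \<in> V \<Longrightarrow> b \<in> V \<Longrightarrow>
      f (z(i := a)) j = f (z(i := b)) j"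
    and x: "x \<in> wpow_V V n" "y \<in> wpow_V V n" and eq: "\<And>i. i < n \<Longrightarrow> i \<in> A \<Longrightarrow> x i = y i"
  shows "f x j = f y j"
proof -
  define z where "z k = (\<lambda>i. if i < k then y i else x i)" for k
  have "k \<le> n \<Longrightarrow> z k \<in> wpow_V V n \<and> f (z k) j = f x j" for k
  proof (induction k)
    case 0
    then show ?case using x by (simp add: z_def)
  next
    case (Suc k)
    then have IH: "z k \<in> wpow_V V n" "f (z k) j = f x j" and k: "k < n" by auto
    have zS: "z (Suc k) = (z k)(k := y k)" and zk: "(z k)(k := x k) = z k"
      by (auto simp: z_def less_Suc_eq fun_eq_iff)
    have "f ((z k)(k := y k)) j = f ((z k)(k := x k)) j"
    proof (cases "k \<in> A")
      case True
      then have "x k = y k" using eq k by blast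
      then show ?thesis by simp
    next
      case False
      show ?thesis by (rule assms(1)[OF k False IH(1) wpow_nth[OF x(2) k] wpow_nth[OF x(1) k]])
    qed
    then show ?case
      using wpow_upd[OF IH(1) k wpow_nth[OF x(2) k]] zS zk IH(2) by metis
  qed
  from this[of n] have "z n \<in> wpow_V V n" "f (z n) j = f x j" by auto
  moreover have "z n = y" by (rule wpow_ext[OF \<open>z n \<in> _\<close> x(2)]) (simp add: z_def)
  ultimately show ?thesis by simp
qed

text \<open>Moving coordinate \<open>i\<close> changes exactly one coordinate
  \<open>\<sigma> i\<close> of the image. Surjectivity of \<open>f\<close> makes
  \<open>\<sigma>\<close> onto, hence a permutation, and its inverse \<open>\<pi>\<close> tells from
  which coordinate each image coordinate is read.\<close>

theorem automorphism_wpow_coordinatewise: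
  assumes prime: "prime_graph V E" and card: "card V \<ge> 2"
  obtains \<pi> \<alpha> where "bij_betw \<pi> {..<n} {..<n}" "\<And>i. i < n \<Longrightarrow> automorphism V E (\<alpha> i)"
    "\<And>x i. x \<in> wpow_V V n \<Longrightarrow> i < n \<Longrightarrow> f x i = \<alpha> i (x (\<pi> i))"
proof -
  obtain a0 b0 where ab: "a0 \<in> V" "b0 \<in> V" "a0 \<noteq> b0"
    using card by (metis card_2_iff' obtain_subset_with_card_n subset_iff)
  define z where "z = (\<lambda>i\<in>{..<n}. a0)"
  have z: "z \<in> wpow_V V n" using ab by (auto simp: z_def wpow_V_def)
  define indep where "indep i j \<longleftrightarrow>
    (\<forall>z\<in>wpow_V V n. \<forall>a\<in>V. \<forall>b\<in>V. f (z(i := a)) j = f (z(i := b)) j)" for i j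
  have "\<exists>j<n. \<not> indep i j" if i: "i < n" for i
  proof (rule ccontr)
    assume "\<not> (\<exists>j<n. \<not> indep i j)"
    then have eq: "f (z(i := a0)) j = f (z(i := b0)) j" if "j < n" for j
      using that z ab unfolding indep_def by blast
    have W: "z(i := a0) \<in> wpow_V V n" "z(i := b0) \<in> wpow_V V n" using z ab i by (simp_all add: wpow_upd)
    have "z(i := a0) = z(i := b0)" by (rule aut_inj[OF W wpow_ext[OF aut_in[OF W(1)] aut_in[OF W(2)] eq]])
    then show False using ab by (metis fun_upd_same)
  qed
  then obtain \<sigma> where \<sigma>: "\<And>i. i < n \<Longrightarrow> \<sigma> i < n \<and> \<not> indep i (\<sigma> i)" by metis
  have indep: "indep i j" if "i < n" "j < n" "j \<noteq> \<sigma> i" for i j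
    using single_coordinate_dependence[OF prime that(1), of "\<sigma> i"] \<sigma>[OF that(1)] that
    unfolding indep_def by blast
  have onto: "j \<in> \<sigma> ` {..<n}" if j: "j < n" for j
  \<comment> \<open>A coordinate missed by \<open>\<sigma>\<close> would be constant on all images,
    although both \<open>a0\<close> and \<open>b0\<close> must occur there.\<close>
  proof (rule ccontr)
    assume "j \<notin> \<sigma> ` {..<n}"
    then have ind: "indep i j" if "i < n" for i using indep that j by blast
    have const: "f x j = f y j" if "x \<in> wpow_V V n" "y \<in> wpow_V V n" for x y
    proof (rule independent_of_coordinates[of "{}"])
      show "f (z(i := a)) j = f (z(i := b)) j" if "i < n" "z \<in> wpow_V V n" "a \<in> V" "b \<in> V" for i z a b
        using ind[OF that(1)] that unfolding indep_def by blast
    qed (use that in auto)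
    obtain x y where xy: "x \<in> wpow_V V n" "f x = z(j := a0)" "y \<in> wpow_V V n" "f y = z(j := b0)"
      using aut_surj z ab j by (metis wpow_upd)
    show False using const[OF xy(1,3)] xy ab by auto
  qed
  have bij\<sigma>: "bij_betw \<sigma> {..<n} {..<n}"
  proof -
    have "\<sigma> ` {..<n} = {..<n}" using onto \<sigma> by auto
    then show ?thesis by (simp add: bij_betw_def eq_card_imp_inj_on)
  qed
  define \<pi> where "\<pi> = inv_into {..<n} \<sigma>"
  have bij\<pi>: "bij_betw \<pi> {..<n} {..<n}" unfolding \<pi>_def by (rule bij_betw_inv_into[OF bij\<sigma>])
  have \<pi>n: "\<pi> j < n" if "j < n" for j using bij\<pi> that by (auto simp: bij_betw_def)
  have \<sigma>\<pi>: "\<sigma> i = j \<Longrightarrow> i = \<pi> j" if "i < n" for i j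
    using that bij_betw_inv_into_left[OF bij\<sigma>] by (auto simp: \<pi>_def)
  define \<alpha> where "\<alpha> j a = f (z(\<pi> j := a)) j" for j a
  have f\<alpha>: "f x j = \<alpha> j (x (\<pi> j))" if x: "x \<in> wpow_V V n" and j: "j < n" for x j
    unfolding \<alpha>_def
  proof (rule independent_of_coordinates[of "{\<pi> j}"])
    fix i w a b assume h: "i < n" "i \<notin> {\<pi> j}" "w \<in> wpow_V V n" "a \<in> V" "b \<in> V"
    then have "indep i j" using \<sigma>\<pi> j by (intro indep) auto
    then show "f (w(i := a)) j = f (w(i := b)) j" using h unfolding indep_def by blast
  next
    show "z(\<pi> j := x (\<pi> j)) \<in> wpow_V V n" using z \<pi>n[OF j] wpow_nth[OF x] by (simp add: wpow_upd)
  qed (use x in auto)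
  have "automorphism V E (\<alpha> j)" if j: "j < n" for j
  proof -
    have into: "\<alpha> j a \<in> V" if "a \<in> V" for a
      unfolding \<alpha>_def by (rule wpow_nth[OF aut_in j]) (use that z \<pi>n[OF j] in \<open>simp add: wpow_upd\<close>)
    have "V \<subseteq> \<alpha> j ` V"
    proof
      fix b assume "b \<in> V"
      then obtain x where x: "x \<in> wpow_V V n" "f x = z(j := b)" using aut_surj z j by (metis wpow_upd)
      have "b = \<alpha> j (x (\<pi> j))" using f\<alpha>[OF x(1) j] x by simp
      then show "b \<in> \<alpha> j ` V" using wpow_nth[OF x(1) \<pi>n[OF j]] by blast
    qed
    then have im: "\<alpha> j ` V = V" using into by blast
    then have inj: "inj_on (\<alpha> j) V" using finite_V by (simp add: eq_card_imp_inj_on)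
    have "E a b \<longleftrightarrow> E (\<alpha> j a) (\<alpha> j b)" if V: "a \<in> V" "b \<in> V" for a b
    proof
      assume "E a b"
      then obtain y where y: "wpow_E E n (z(\<pi> j := a)) y" "y (\<pi> j) = b"
        using ex_wpow_edge[OF z \<pi>n[OF j]] by blast
      then have "wpow_E E n (f (z(\<pi> j := a))) (f y)" using aut_edge wpow_edge_in by blast
      then have "E (f (z(\<pi> j := a)) j) (f y j)" using j by (auto simp: wpow_E_def)
      then show "E (\<alpha> j a) (\<alpha> j b)"
        using f\<alpha>[OF _ j] wpow_edge_in[OF y(1)] y(2) by simp
    next
      \<comment> \<open>This edge is lifted to the power and pulled back through \<open>f\<close>;
        injectivity of \<open>\<alpha> j\<close> identifies the ends in coordinate
        \<open>\<pi> j\<close>.\<close>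
      assume "E (\<alpha> j a) (\<alpha> j b)"
      then obtain y where y: "wpow_E E n (z(j := \<alpha> j a)) y" "y j = \<alpha> j b"
        using ex_wpow_edge[OF z j] by blast
      then obtain u v where uv: "u \<in> wpow_V V n" "f u = z(j := \<alpha> j a)" "v \<in> wpow_V V n" "f v = y"
        using wpow_edge_in aut_surj by metis
      then have "wpow_E E n u v" using y aut_edge by metis
      then have e: "E (u (\<pi> j)) (v (\<pi> j))" using \<pi>n[OF j] by (auto simp: wpow_E_def)
      have "\<alpha> j (u (\<pi> j)) = \<alpha> j a" "\<alpha> j (v (\<pi> j)) = \<alpha> j b"
        using f\<alpha>[OF uv(1) j] f\<alpha>[OF uv(3) j] uv y by auto
      then have "u (\<pi> j) = a" "v (\<pi> j) = b"
        using inj V wpow_nth[OF uv(1) \<pi>n[OF j]] wpow_nth[OF uv(3) \<pi>n[OF j]] by (auto dest: inj_onD)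
      then show "E a b" using e by simp
    qed
    then show ?thesis using inj im by (auto simp: automorphism_def graph_iso_def bij_betw_def)
  qed
  then show ?thesis using that bij\<pi> f\<alpha> by blast
qed

end

end

subsection \<open>Subsets of a power without coordinatewise symmetries\<close>

definition coord_map :: "nat \<Rightarrow> (nat \<Rightarrow> nat) \<Rightarrow> (nat \<Rightarrow> 'a \<Rightarrow> 'a) \<Rightarrow> (nat \<Rightarrow> 'a) \<Rightarrow> nat \<Rightarrow> 'a" where
  "coord_map m \<pi> \<alpha> x = (\<lambda>i\<in>{..<m}. \<alpha> i (x (\<pi> i)))"

definition coord_perm :: "'a set \<Rightarrow> nat \<Rightarrow> (nat \<Rightarrow> nat) \<Rightarrow> (nat \<Rightarrow> 'a \<Rightarrow> 'a) \<Rightarrow> bool" where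
  "coord_perm V m \<pi> \<alpha> \<longleftrightarrow> bij_betw \<pi> {..<m} {..<m} \<and> (\<forall>i<m. bij_betw (\<alpha> i) V V)"

definition coord_rigid :: "'a set \<Rightarrow> nat \<Rightarrow> (nat \<Rightarrow> 'a) set set \<Rightarrow> bool" where
  "coord_rigid V m F \<longleftrightarrow> (\<forall>\<pi> \<alpha>. coord_perm V m \<pi> \<alpha> \<and>
     (\<forall>S\<in>F. \<forall>x\<in>wpow_V V m. coord_map m \<pi> \<alpha> x \<in> S \<longleftrightarrow> x \<in> S) \<longrightarrow>
     (\<forall>x\<in>wpow_V V m. coord_map m \<pi> \<alpha> x = x))"

text \<open>The index \<open>m\<close> is the last coordinate in dimension \<open>Suc m\<close>;
  \<open>U a\<close> prescribes the slice over the value \<open>a\<close> there.\<close>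

definition fibred :: "'a set \<Rightarrow> nat \<Rightarrow> ('a \<Rightarrow> (nat \<Rightarrow> 'a) set) \<Rightarrow> (nat \<Rightarrow> 'a) set" where
  "fibred V m U = {x \<in> wpow_V V (Suc m). restrict x {..<m} \<in> U (x m)}"

lemma coord_permD:
  assumes "coord_perm V m \<pi> \<alpha>"
  shows "i < m \<Longrightarrow> \<pi> i < m" "i < m \<Longrightarrow> a \<in> V \<Longrightarrow> \<alpha> i a \<in> V"
    "i < m \<Longrightarrow> inj_on (\<alpha> i) V" "k < m \<Longrightarrow> \<exists>i<m. \<pi> i = k"
    "i < m \<Longrightarrow> b \<in> V \<Longrightarrow> \<exists>a\<in>V. \<alpha> i a = b"
proof -
  have \<pi>: "\<pi> ` {..<m} = {..<m}" and \<alpha>: "\<And>i. i < m \<Longrightarrow> inj_on (\<alpha> i) V \<and> \<alpha> i ` V = V"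
    using assms by (auto simp: coord_perm_def bij_betw_def)
  show "i < m \<Longrightarrow> \<pi> i < m" using \<pi> by auto
  show "i < m \<Longrightarrow> a \<in> V \<Longrightarrow> \<alpha> i a \<in> V" using \<alpha> by blast
  show "i < m \<Longrightarrow> inj_on (\<alpha> i) V" using \<alpha> by blast
  show "k < m \<Longrightarrow> \<exists>i<m. \<pi> i = k" using \<pi> by (metis imageE lessThan_iff)
  show "i < m \<Longrightarrow> b \<in> V \<Longrightarrow> \<exists>a\<in>V. \<alpha> i a = b" using \<alpha> by (metis imageE)
qed

lemma coord_map_in:
  assumes "coord_perm V m \<pi> \<alpha>" "x \<in> wpow_V V m"
  shows "coord_map m \<pi> \<alpha> x \<in> wpow_V V m"
  using coord_permD(1,2)[OF assms(1)] wpow_nth[OF assms(2)]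
  by (auto simp: coord_map_def wpow_V_def)

lemma coord_map_bij:
  assumes "finite V" "coord_perm V m \<pi> \<alpha>"
  shows "bij_betw (coord_map m \<pi> \<alpha>) (wpow_V V m) (wpow_V V m)"
proof -
  have "inj_on (coord_map m \<pi> \<alpha>) (wpow_V V m)"
  proof (rule inj_onI)
    fix x y assume xy: "x \<in> wpow_V V m" "y \<in> wpow_V V m" "coord_map m \<pi> \<alpha> x = coord_map m \<pi> \<alpha> y"
    show "x = y"
    proof (rule wpow_ext[OF xy(1,2)])
      fix k assume "k < m"
      then obtain i where i: "i < m" "\<pi> i = k" using coord_permD(4)[OF assms(2)] by blast
      then have "\<alpha> i (x k) = \<alpha> i (y k)" using fun_cong[OF xy(3), of i] by (simp add: coord_map_def)
      then show "x k = y k"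
        using coord_permD(3)[OF assms(2) i(1)] wpow_nth xy \<open>k < m\<close> by (meson inj_onD)
    qed
  qed
  moreover have "finite (wpow_V V m)" unfolding wpow_V_def by (rule finite_PiE) (auto simp: assms)
  moreover have "coord_map m \<pi> \<alpha> ` wpow_V V m \<subseteq> wpow_V V m" using coord_map_in[OF assms(2)] by blast
  ultimately show ?thesis by (simp add: bij_betw_def endo_inj_surj)
qed

lemma wpow_snoc: "y \<in> wpow_V V m \<Longrightarrow> a \<in> V \<Longrightarrow> y(m := a) \<in> wpow_V V (Suc m)"
  by (auto simp: wpow_V_def PiE_iff extensional_def less_Suc_eq)

lemma wpow_init: "x \<in> wpow_V V (Suc m) \<Longrightarrow> restrict x {..<m} \<in> wpow_V V m"
  by (auto simp: wpow_V_def PiE_iff)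

lemma restrict_snoc: "y \<in> wpow_V V m \<Longrightarrow> restrict (y(m := a)) {..<m} = y"
  by (auto simp: wpow_V_def PiE_iff extensional_def fun_eq_iff)

lemma snoc_in_fibred:
  "y \<in> wpow_V V m \<Longrightarrow> a \<in> V \<Longrightarrow> y(m := a) \<in> fibred V m U \<longleftrightarrow> y \<in> U a"
  using restrict_snoc[of y V m a] by (simp add: fibred_def wpow_snoc)

lemma coord_perm_init:
  assumes "coord_perm V (Suc m) \<pi> \<alpha>" "\<pi> m = m"
  shows "coord_perm V m \<pi> \<alpha>"
proof -
  have "bij_betw \<pi> ({..<Suc m} - {m}) ({..<Suc m} - {m})"
    using assms by (intro bij_betw_DiffI) (auto simp: coord_perm_def bij_betw_def)
  moreover have "{..<Suc m} - {m} = {..<m}" by auto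
  ultimately show ?thesis using assms(1) by (auto simp: coord_perm_def)
qed

lemma coord_map_snoc:
  assumes "coord_perm V (Suc m) \<pi> \<alpha>" "\<pi> m = m" "y \<in> wpow_V V m"
  shows "coord_map (Suc m) \<pi> \<alpha> (y(m := a)) = (coord_map m \<pi> \<alpha> y)(m := \<alpha> m a)"
proof -
  have "\<pi> i < m" if "i < m" for i
    using coord_permD(1)[OF coord_perm_init[OF assms(1,2)] that] .
  then have "\<pi> i \<noteq> m" if "i < m" for i using that by fastforce
  then show ?thesis using assms(2) by (auto simp: coord_map_def fun_eq_iff less_Suc_eq)
qed

lemma fibre_preserved:
  assumes cp: "coord_perm V (Suc m) \<pi> \<alpha>" and m: "\<pi> m = m"
    and pres: "\<And>x. x \<in> wpow_V V (Suc m) \<Longrightarrow>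
      coord_map (Suc m) \<pi> \<alpha> x \<in> fibred V m U \<longleftrightarrow> x \<in> fibred V m U"
    and y: "y \<in> wpow_V V m" and a: "a \<in> V"
  shows "coord_map m \<pi> \<alpha> y \<in> U (\<alpha> m a) \<longleftrightarrow> y \<in> U a"
proof -
  have "(coord_map m \<pi> \<alpha> y)(m := \<alpha> m a) \<in> fibred V m U \<longleftrightarrow> y(m := a) \<in> fibred V m U"
    using pres[OF wpow_snoc[OF y a]] coord_map_snoc[OF cp m y] by simp
  then show ?thesis
    using snoc_in_fibred[OF y a] snoc_in_fibred[OF coord_map_in[OF coord_perm_init[OF cp m] y], of "\<alpha> m a"]
      coord_permD(2)[OF cp _ a, of m] by auto
qed

text \<open>A symmetry that keeps the last coordinate in place carries the fibre over
  \<open>a\<close> bijectively onto that over \<open>\<alpha> m a\<close>. Distinct cardinalities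
  force the two values to agree on \<open>C\<close>, so each fibre over \<open>C\<close> is
  preserved and rigidity of these fibres applies. The set \<open>C\<close> is all of
  \<open>V\<close> in the inductive construction and a color class in the final coloring.\<close>

lemma fibres_fixed:
  assumes fin: "finite V" and cp: "coord_perm V (Suc m) \<pi> \<alpha>" and m: "\<pi> m = m"
    and pres: "\<And>x. x \<in> wpow_V V (Suc m) \<Longrightarrow>
      coord_map (Suc m) \<pi> \<alpha> x \<in> fibred V m U \<longleftrightarrow> x \<in> fibred V m U"
    and U: "\<And>a. a \<in> V \<Longrightarrow> U a \<subseteq> wpow_V V m"
    and C: "C \<subseteq> V" "\<And>a. a \<in> C \<Longrightarrow> \<alpha> m a \<in> C" and inj: "inj_on (\<lambda>a. card (U a)) C"
    and rigid: "coord_rigid V m (U ` C)"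
  shows "\<And>a. a \<in> C \<Longrightarrow> \<alpha> m a = a" and "\<And>y. y \<in> wpow_V V m \<Longrightarrow> coord_map m \<pi> \<alpha> y = y"
proof -
  note fp = fibre_preserved[OF cp m pres]
  note cp' = coord_perm_init[OF cp m]
  note bij = coord_map_bij[OF fin cp']
  show fix_a: "\<alpha> m a = a" if a: "a \<in> C" for a
  proof -
    have V: "a \<in> V" "\<alpha> m a \<in> V" using a C by auto
    have "coord_map m \<pi> \<alpha> ` U a = U (\<alpha> m a)"
    proof
      show "coord_map m \<pi> \<alpha> ` U a \<subseteq> U (\<alpha> m a)" using fp U V by blast
      show "U (\<alpha> m a) \<subseteq> coord_map m \<pi> \<alpha> ` U a"
      proof
        fix w assume w: "w \<in> U (\<alpha> m a)"
        then have "w \<in> wpow_V V m" using U V by blast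
        then obtain y where "y \<in> wpow_V V m" "w = coord_map m \<pi> \<alpha> y"
          using bij by (metis bij_betw_def imageE)
        then show "w \<in> coord_map m \<pi> \<alpha> ` U a" using fp w V by blast
      qed
    qed
    moreover have "inj_on (coord_map m \<pi> \<alpha>) (U a)"
      using bij U V by (meson bij_betw_def inj_on_subset)
    ultimately have "card (U (\<alpha> m a)) = card (U a)" by (metis card_image)
    then show ?thesis using inj a C(2) by (meson inj_onD)
  qed
  have "\<forall>S\<in>U ` C. \<forall>x\<in>wpow_V V m. coord_map m \<pi> \<alpha> x \<in> S \<longleftrightarrow> x \<in> S"
  proof (intro ballI)
    fix S x assume "S \<in> U ` C" and x: "x \<in> wpow_V V m"
    then obtain a where a: "a \<in> C" "S = U a" by blast
    then show "coord_map m \<pi> \<alpha> x \<in> S \<longleftrightarrow> x \<in> S"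
      using fp[OF _ x, of a] fix_a[OF a(1)] C(1) by auto
  qed
  then show "coord_map m \<pi> \<alpha> y = y" if "y \<in> wpow_V V m" for y
    using rigid cp' that unfolding coord_rigid_def by blast
qed

section \<open>Construction of rigid sets by increasing dimension\<close>

lemma family_with_distinct_cards:
  assumes "finite V" "finite X" "card V \<le> card X + 1" "K \<subseteq> V" "\<And>a. a \<in> K \<Longrightarrow> g a \<subseteq> X"
    and inj: "inj_on (\<lambda>a. card (g a)) K"
  obtains U where "\<And>a. U a \<subseteq> X" "\<And>a. a \<in> K \<Longrightarrow> U a = g a" "inj_on (\<lambda>a. card (U a)) V"
proof -
  let ?c = "\<lambda>a. card (g a)" and ?N = "{..card X}"
  have finK: "finite K" using assms finite_subset by blast
  have "?c ` K \<subseteq> ?N" using assms by (auto intro: card_mono)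
  then have "card (?N - ?c ` K) = card X + 1 - card K"
    using inj finK by (simp add: card_Diff_subset card_image)
  moreover have "card (V - K) = card V - card K" using assms finK by (simp add: card_Diff_subset)
  ultimately have "card (V - K) \<le> card (?N - ?c ` K)" using assms by simp
  then obtain h where h: "h ` (V - K) \<subseteq> ?N - ?c ` K" "inj_on h (V - K)"
    using card_le_inj[of "V - K" "?N - ?c ` K"] assms by auto
  have "\<exists>S. S \<subseteq> X \<and> card S = h a" if a: "a \<in> V - K" for a
  proof -
    have "h a \<in> ?N" using h(1) a by blast
    then show ?thesis using obtain_subset_with_card_n[of "h a" X] by (metis atMost_iff)
  qed
  then obtain s where s: "\<And>a. a \<in> V - K \<Longrightarrow> s a \<subseteq> X \<and> card (s a) = h a" by metis
  define U where "U a = (if a \<in> K then g a else if a \<in> V then s a else {})" for a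
  have "inj_on (\<lambda>a. card (U a)) V"
  proof (rule inj_onI)
    fix a b assume ab: "a \<in> V" "b \<in> V" "card (U a) = card (U b)"
    have *: "h a \<noteq> card (g b)" if "a \<in> V - K" "b \<in> K" for a b using h(1) that by blast
    show "a = b"
      using ab * s inj h(2) by (cases "a \<in> K"; cases "b \<in> K") (auto simp: U_def dest: inj_onD, metis Diff_iff *)
  qed
  moreover have "U a \<subseteq> X" for a using s assms(5) by (auto simp: U_def)
  ultimately show ?thesis using that[of U] by (simp add: U_def)
qed

lemma card_le_card_wpow:
  assumes "finite V" "m > 0" shows "card V \<le> card (wpow_V V m)"
proof -
  have "inj_on (\<lambda>a. \<lambda>i\<in>{..<m}. a) V"
    by (rule inj_onI) (use assms(2) in \<open>metis lessThan_iff restrict_apply'\<close>)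
  moreover have "(\<lambda>a. \<lambda>i\<in>{..<m}. a) ` V \<subseteq> wpow_V V m" by (auto simp: wpow_V_def split: if_splits)
  moreover have "finite (wpow_V V m)" unfolding wpow_V_def by (rule finite_PiE) (auto simp: assms)
  ultimately show ?thesis by (rule card_inj_on_le)
qed

text \<open>The last coordinate of the new set is recognised as the only one with an empty slice, and
  its values are recognised by the cardinalities of their slices.\<close>

lemma coord_rigid_step:
  assumes fin: "finite V" and card: "card V \<ge> 3" and m: "m > 0"
    and AB: "A \<subseteq> wpow_V V m" "B \<subseteq> wpow_V V m" "A \<noteq> {}" "card A < card B"
    and slices: "\<And>i b. i < m \<Longrightarrow> b \<in> V \<Longrightarrow> \<exists>x\<in>A \<union> B. x i = b"
    and rigid: "coord_rigid V m {A, B}"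
  obtains T where "T \<subseteq> wpow_V V (Suc m)" "T \<noteq> {}" "T \<noteq> wpow_V V (Suc m)" "coord_rigid V (Suc m) {T}"
proof -
  obtain S where "S \<subseteq> V" "card S = 3" using obtain_subset_with_card_n[OF card] by blast
  then obtain v0 v1 v2 where v: "v0 \<in> V" "v1 \<in> V" "v2 \<in> V" "v0 \<noteq> v1" "v0 \<noteq> v2" "v1 \<noteq> v2"
    unfolding card_3_iff by blast
  have finW: "finite (wpow_V V m)" unfolding wpow_V_def by (rule finite_PiE) (auto simp: fin)
  have A: "card A > 0" using AB finW finite_subset by (metis card_gt_0_iff)
  \<comment> \<open>Three values of \<open>V\<close> receive prescribed slices of sizes
    \<open>0 < card A < card B\<close>; the empty one marks the last coordinate.\<close>
  define g where "g a = (if a = v0 then {} else if a = v1 then A else B)" for a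
  obtain U where U: "\<And>a. U a \<subseteq> wpow_V V m" "\<And>a. a \<in> {v0, v1, v2} \<Longrightarrow> U a = g a"
    "inj_on (\<lambda>a. card (U a)) V"
  proof (rule family_with_distinct_cards[OF fin finW, of "{v0, v1, v2}" g])
    show "card V \<le> card (wpow_V V m) + 1" using card_le_card_wpow[OF fin m] by simp
    show "inj_on (\<lambda>a. card (g a)) {v0, v1, v2}" using A AB v by (auto simp: inj_on_def g_def)
  qed (use v AB in \<open>auto simp: g_def\<close>)
  have Uv: "U v0 = {}" "U v1 = A" "U v2 = B" using U(2) v by (auto simp: g_def)
  let ?T = "fibred V m U"
  obtain y where y: "y \<in> A" using AB by auto
  have "y(m := v1) \<in> ?T" "y(m := v0) \<notin> ?T" "y(m := v0) \<in> wpow_V V (Suc m)"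
    using y AB v Uv snoc_in_fibred[of y V m] by (auto intro: wpow_snoc)
  moreover have "coord_rigid V (Suc m) {?T}"
    unfolding coord_rigid_def
  proof (intro allI impI ballI, elim conjE)
    fix \<pi> \<alpha> x
    assume cp: "coord_perm V (Suc m) \<pi> \<alpha>" and x: "x \<in> wpow_V V (Suc m)"
      and "\<forall>S\<in>{?T}. \<forall>x\<in>wpow_V V (Suc m). coord_map (Suc m) \<pi> \<alpha> x \<in> S \<longleftrightarrow> x \<in> S"
    then have pres: "\<And>x. x \<in> wpow_V V (Suc m) \<Longrightarrow> coord_map (Suc m) \<pi> \<alpha> x \<in> ?T \<longleftrightarrow> x \<in> ?T" by blast
    \<comment> \<open>Otherwise the last coordinate of the image is read from an earlier one. Since
      \<open>A\<close> and \<open>B\<close> attain every value there, some vertex of the set would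
      be sent into the empty slice over \<open>v0\<close>.\<close>
    have "\<pi> m = m"
    proof (rule ccontr)
      assume "\<pi> m \<noteq> m"
      then have k: "\<pi> m < m" using coord_permD(1)[OF cp, of m] by simp
      obtain b where b: "b \<in> V" "\<alpha> m b = v0" using coord_permD(5)[OF cp _ v(1)] by blast
      obtain y where y: "y \<in> A \<union> B" "y (\<pi> m) = b" using slices[OF k b(1)] by blast
      have yW: "y \<in> wpow_V V m" using y AB by blast
      obtain a where a: "a \<in> V" "y \<in> U a" using y Uv v by blast
      then have "coord_map (Suc m) \<pi> \<alpha> (y(m := a)) \<in> ?T"
        using pres[OF wpow_snoc[OF yW a(1)]] snoc_in_fibred[OF yW a(1)] by simp
      moreover have "coord_map (Suc m) \<pi> \<alpha> (y(m := a)) m = v0"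
        using y b k by (simp add: coord_map_def)
      ultimately show False using Uv by (simp add: fibred_def)
    qed
    note \<pi>m = this
    have rig: "coord_rigid V m (U ` V)"
    proof -
      have "A \<in> U ` V" "B \<in> U ` V" using Uv v by blast+
      then show ?thesis using rigid unfolding coord_rigid_def by blast
    qed
    have \<alpha>V: "\<And>a. a \<in> V \<Longrightarrow> \<alpha> m a \<in> V" using coord_permD(2)[OF cp, of m] by blast
    have fixed: "\<alpha> m a = a" if "a \<in> V" for a
      by (rule fibres_fixed(1)[OF fin cp \<pi>m _ _ _ _ U(3) rig that]) (use pres U(1) \<alpha>V in auto)
    have fixed': "coord_map m \<pi> \<alpha> y = y" if "y \<in> wpow_V V m" for y
      by (rule fibres_fixed(2)[OF fin cp \<pi>m _ _ _ _ U(3) rig that]) (use pres U(1) \<alpha>V in auto)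
    have xm: "x m \<in> V" using wpow_nth[OF x] by simp
    have xr: "(restrict x {..<m})(m := x m) = x"
      by (rule wpow_ext[OF wpow_snoc[OF wpow_init[OF x] xm] x]) auto
    have "coord_map (Suc m) \<pi> \<alpha> ((restrict x {..<m})(m := x m)) = (restrict x {..<m})(m := x m)"
      unfolding coord_map_snoc[OF cp \<pi>m wpow_init[OF x]] fixed[OF xm] fixed'[OF wpow_init[OF x]] ..
    then show "coord_map (Suc m) \<pi> \<alpha> x = x" using xr by simp
  qed
  moreover have "?T \<subseteq> wpow_V V (Suc m)" by (auto simp: fibred_def)
  ultimately show ?thesis using that[of ?T] by blast
qed

text \<open>With \<open>V\<close> numbered by \<open>h\<close>, \<open>A\<close> is the strict order
  and \<open>B\<close> excludes the least first coordinate. The set \<open>B\<close> rules out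
  swapping the coordinates; preserving \<open>A\<close> preserves how many elements lie below or
  above, and these counts determine each element.\<close>

lemma coord_rigid_pair:
  assumes fin: "finite V" and card: "card V \<ge> 3"
  obtains A B where "A \<subseteq> wpow_V V 2" "B \<subseteq> wpow_V V 2" "A \<noteq> {}" "card A < card B"
    "\<forall>i<2. \<forall>b\<in>V. \<exists>x\<in>A \<union> B. x i = b" "coord_rigid V 2 {A, B}"
proof -
  define N where "N = card V"
  obtain h where h: "bij_betw h V {0..<N}" using ex_bij_betw_finite_nat[OF fin] by (auto simp: N_def)
  have hinj: "h a = h b \<Longrightarrow> a = b" if "a \<in> V" "b \<in> V" for a b
    using h that by (auto simp: bij_betw_def inj_on_def)
  have hN: "h a < N" if "a \<in> V" for a using h that by (auto simp: bij_betw_def)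
  have hsurj: "\<exists>a\<in>V. h a = k" if "k < N" for k
    using h that by (metis atLeastLessThan_iff bij_betw_def imageE le0)
  define pr where "pr a b = (\<lambda>i\<in>{..<2::nat}. if i = 0 then a else b)" for a b :: 'a
  have pr: "pr a b 0 = a" "pr a b (Suc 0) = b" for a b by (auto simp: pr_def)
  have prV: "pr a b \<in> wpow_V V 2" if "a \<in> V" "b \<in> V" for a b
    using that by (auto simp: pr_def wpow_V_def)
  have less2: "i < 2 \<longleftrightarrow> i = 0 \<or> i = Suc 0" for i by auto
  define A where "A = {x \<in> wpow_V V 2. h (x 0) < h (x 1)}"
  define B where "B = {x \<in> wpow_V V 2. h (x 0) \<noteq> 0}"
  obtain v0 v1 where v: "v0 \<in> V" "h v0 = 0" "v1 \<in> V" "h v1 = 1"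
    using hsurj[of 0] hsurj[of 1] card by (auto simp: N_def)
  have finW: "finite (wpow_V V 2)" unfolding wpow_V_def by (rule finite_PiE) (auto simp: fin)
  have finB: "finite B" using finW by (simp add: B_def)
  have "card A < card B"
  proof -
    \<comment> \<open>Swapping a pair of \<open>A\<close> puts the larger entry first, so its number
      is not 0; the diagonal pair of \<open>v1\<close> in \<open>B\<close> is missed.\<close>
    let ?sw = "\<lambda>x. pr (x 1) (x 0)"
    have "inj_on ?sw A"
    proof (rule inj_onI)
      fix x y assume xy: "x \<in> A" "y \<in> A" "?sw x = ?sw y"
      then have "x 1 = y 1" "x 0 = y 0" by (metis pr)+
      then show "x = y" using xy by (intro wpow_ext[of _ V 2]) (auto simp: A_def less2)
    qed
    moreover have "?sw ` A \<subset> B"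
    proof
      show "?sw ` A \<subseteq> B" by (auto simp: A_def B_def pr intro!: prV wpow_nth[of _ V 2])
      have "pr v1 v1 \<in> B" using v prV by (simp add: B_def pr)
      moreover have "pr v1 v1 \<notin> ?sw ` A"
      proof
        assume "pr v1 v1 \<in> ?sw ` A"
        then obtain x where x: "x \<in> A" "pr v1 v1 = ?sw x" by blast
        then have "x 1 = v1" "x 0 = v1" by (metis pr)+
        then show False using x by (simp add: A_def)
      qed
      ultimately show "?sw ` A \<noteq> B" by blast
    qed
    ultimately show ?thesis using finB by (metis card_image psubset_card_mono)
  qed
  moreover have "pr v0 v1 \<in> A" using v prV by (simp add: A_def pr)
  moreover have "\<exists>x\<in>A \<union> B. x i = b" if ib: "i < 2" "b \<in> V" for i b
  proof (cases "i = 0")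
    case True
    show ?thesis
    proof (cases "h b = 0")
      case True
      then have "b = v0" using hinj v ib by simp
      then show ?thesis using \<open>pr v0 v1 \<in> A\<close> \<open>i = 0\<close> pr by blast
    next
      case False
      then have "pr b b \<in> B" using ib prV by (simp add: B_def pr)
      then show ?thesis using \<open>i = 0\<close> pr by blast
    qed
  next
    case False
    then have "i = Suc 0" using ib by simp
    moreover have "pr v1 b \<in> B" using ib prV v by (simp add: B_def pr)
    ultimately show ?thesis using pr by blast
  qed
  moreover have "coord_rigid V 2 {A, B}"
    unfolding coord_rigid_def
  proof (intro allI impI ballI, elim conjE)
    fix \<pi> \<alpha> x
    assume cp: "coord_perm V 2 \<pi> \<alpha>" and x: "x \<in> wpow_V V 2"
      and inv: "\<forall>S\<in>{A, B}. \<forall>x\<in>wpow_V V 2. coord_map 2 \<pi> \<alpha> x \<in> S \<longleftrightarrow> x \<in> S"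
    have invA: "coord_map 2 \<pi> \<alpha> y \<in> A \<longleftrightarrow> y \<in> A" if "y \<in> wpow_V V 2" for y
      using inv that by simp
    have invB: "coord_map 2 \<pi> \<alpha> y \<in> B \<longleftrightarrow> y \<in> B" if "y \<in> wpow_V V 2" for y
      using inv that by simp
    note cpi = coord_map_in[OF cp]
    have \<alpha>V: "\<alpha> 0 a \<in> V" "\<alpha> (Suc 0) a \<in> V" if "a \<in> V" for a using coord_permD(2)[OF cp] that by auto
    have \<pi>0: "\<pi> 0 = 0"
    proof (rule ccontr)
      assume "\<pi> 0 \<noteq> 0"
      then have p: "\<pi> 0 = Suc 0" using coord_permD(1)[OF cp, of 0] by (simp add: less2)
      \<comment> \<open>Under a swap the pair of \<open>v0\<close> and \<open>b\<close>, which is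
        outside \<open>B\<close>, would get first coordinate \<open>v1\<close> and land in
        \<open>B\<close>.\<close>
      obtain b where b: "b \<in> V" "\<alpha> 0 b = v1" using coord_permD(5)[OF cp _ v(3), of 0] by auto
      have "coord_map 2 \<pi> \<alpha> (pr v0 b) \<in> B \<longleftrightarrow> pr v0 b \<in> B" by (rule invB[OF prV[OF v(1) b(1)]])
      then show False
        using cpi[OF prV[OF v(1) b(1)]] v b p by (simp add: B_def pr coord_map_def)
    qed
    have \<pi>1: "\<pi> (Suc 0) = Suc 0"
    proof -
      obtain i where "i < 2" "\<pi> i = Suc 0" using coord_permD(4)[OF cp, of "Suc 0"] by auto
      then show ?thesis using \<pi>0 by (auto simp: less2)
    qed
    have ord: "h (\<alpha> 0 a) < h (\<alpha> (Suc 0) b) \<longleftrightarrow> h a < h b" if ab: "a \<in> V" "b \<in> V" for a b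
    proof -
      have "coord_map 2 \<pi> \<alpha> (pr a b) \<in> A \<longleftrightarrow> pr a b \<in> A" by (rule invA[OF prV[OF ab]])
      then show ?thesis
        using cpi[OF prV[OF ab]] prV[OF ab] \<pi>0 \<pi>1 by (simp add: A_def pr coord_map_def)
    qed
    have hcard: "card {a\<in>V. h a < k} = k" "card {a\<in>V. k < h a} = N - Suc k" if "k < N" for k
    proof -
      have img: "card {a\<in>V. Q (h a)} = card {j. j < N \<and> Q j}" for Q
      proof -
        have "h ` {a\<in>V. Q (h a)} = {j. j < N \<and> Q j}"
        proof (intro equalityI subsetI)
          fix j assume "j \<in> {j. j < N \<and> Q j}"
          then obtain a where "a \<in> V" "h a = j" "Q j" using hsurj by blast
          then show "j \<in> h ` {a\<in>V. Q (h a)}" by blast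
        qed (use hN in auto)
        moreover have "inj_on h {a\<in>V. Q (h a)}" using hinj by (auto intro: inj_onI)
        ultimately show ?thesis by (metis card_image)
      qed
      have "{j. j < N \<and> j < k} = {0..<k}" "{j. j < N \<and> k < j} = {Suc k..<N}" using that by auto
      then show "card {a\<in>V. h a < k} = k" "card {a\<in>V. k < h a} = N - Suc k"
        using img[of "\<lambda>j. j < k"] img[of "\<lambda>j. k < j"] by simp_all
    qed
    have inj: "inj_on (\<alpha> 0) V" "inj_on (\<alpha> (Suc 0)) V"
      using coord_permD(3)[OF cp, of 0] coord_permD(3)[OF cp, of "Suc 0"] by auto
    have "\<alpha> (Suc 0) b = b" if b: "b \<in> V" for b
    proof -
      have "\<alpha> 0 ` {a\<in>V. h a < h b} = {a\<in>V. h a < h (\<alpha> (Suc 0) b)}"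
      proof (intro equalityI subsetI)
        fix c assume "c \<in> {a\<in>V. h a < h (\<alpha> (Suc 0) b)}"
        then obtain a where "a \<in> V" "c = \<alpha> 0 a" "h c < h (\<alpha> (Suc 0) b)"
          using coord_permD(5)[OF cp, of 0 c] by auto
        then show "c \<in> \<alpha> 0 ` {a\<in>V. h a < h b}" using ord b by auto
      qed (use ord b \<alpha>V in auto)
      then have "card {a\<in>V. h a < h (\<alpha> (Suc 0) b)} = card {a\<in>V. h a < h b}"
        using card_image[OF inj_on_subset[OF inj(1)], of "{a\<in>V. h a < h b}"] by auto
      then have "h (\<alpha> (Suc 0) b) = h b"
        using hcard(1)[OF hN[OF b]] hcard(1)[OF hN[OF \<alpha>V(2)[OF b]]] by simp
      then show ?thesis by (rule hinj[OF \<alpha>V(2)[OF b] b])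
    qed
    moreover have "\<alpha> 0 b = b" if b: "b \<in> V" for b
    proof -
      have "\<alpha> (Suc 0) ` {a\<in>V. h b < h a} = {a\<in>V. h (\<alpha> 0 b) < h a}"
      proof (intro equalityI subsetI)
        fix c assume "c \<in> {a\<in>V. h (\<alpha> 0 b) < h a}"
        then obtain a where "a \<in> V" "c = \<alpha> (Suc 0) a" "h (\<alpha> 0 b) < h c"
          using coord_permD(5)[OF cp, of "Suc 0" c] by auto
        then show "c \<in> \<alpha> (Suc 0) ` {a\<in>V. h b < h a}" using ord b by auto
      qed (use ord b \<alpha>V in auto)
      then have "card {a\<in>V. h (\<alpha> 0 b) < h a} = card {a\<in>V. h b < h a}"
        using card_image[OF inj_on_subset[OF inj(2)], of "{a\<in>V. h b < h a}"] by auto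
      then have "N - Suc (h (\<alpha> 0 b)) = N - Suc (h b)" 
        using hcard(2)[OF hN[OF b]] hcard(2)[OF hN[OF \<alpha>V(1)[OF b]]] by simp
      then have "h (\<alpha> 0 b) = h b" using hN[OF b] hN[OF \<alpha>V(1)[OF b]] by linarith
      then show ?thesis by (rule hinj[OF \<alpha>V(1)[OF b] b])
    qed
    ultimately have "coord_map 2 \<pi> \<alpha> x i = x i" if "i < 2" for i
      using that \<pi>0 \<pi>1 wpow_nth[OF x, of 0] wpow_nth[OF x, of "Suc 0"]
      unfolding less2 by (elim disjE) (simp_all add: coord_map_def)
    then show "coord_map 2 \<pi> \<alpha> x = x" by (rule wpow_ext[OF cpi[OF x] x])
  qed
  moreover have "A \<subseteq> wpow_V V 2" "B \<subseteq> wpow_V V 2" by (auto simp: A_def B_def)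
  ultimately show ?thesis by (intro that[of A B]) blast+
qed

text \<open>Dimension 3 comes from the pair in dimension 2. Afterwards the whole power serves as the
  larger second set: it attains all values in all coordinates, and adding it to the family keeps
  rigidity. That \<open>T\<close> is nonempty and proper is carried along to get the strict sizes
  for the next step.\<close>

lemma ex_coord_rigid_set:
  assumes fin: "finite V" and card: "card V \<ge> 3" and m: "m \<ge> 3"
  shows "\<exists>T. T \<subseteq> wpow_V V m \<and> T \<noteq> {} \<and> T \<noteq> wpow_V V m \<and> coord_rigid V m {T}"
  using m
proof (induction m rule: dec_induct)
  case base
  obtain A B where AB: "A \<subseteq> wpow_V V 2" "B \<subseteq> wpow_V V 2" "A \<noteq> {}" "card A < card B"
    "\<forall>i<2. \<forall>b\<in>V. \<exists>x\<in>A \<union> B. x i = b" "coord_rigid V 2 {A, B}"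
    by (rule coord_rigid_pair[OF fin card])
  obtain T where "T \<subseteq> wpow_V V (Suc 2)" "T \<noteq> {}" "T \<noteq> wpow_V V (Suc 2)" "coord_rigid V (Suc 2) {T}"
    by (rule coord_rigid_step[OF fin card _ AB(1-4) _ AB(6)]) (use AB(5) in auto)
  moreover have "Suc 2 = 3" by simp
  ultimately show ?case by metis
next
  case (step m)
  then obtain T where T: "T \<subseteq> wpow_V V m" "T \<noteq> {}" "T \<noteq> wpow_V V m" "coord_rigid V m {T}" by blast
  have finW: "finite (wpow_V V m)" unfolding wpow_V_def by (rule finite_PiE) (auto simp: fin)
  have card_T: "card T < card (wpow_V V m)" using T finW by (simp add: psubset_card_mono psubset_eq)
  have slices: "\<exists>x\<in>T \<union> wpow_V V m. x i = b" if "i < m" "b \<in> V" for i b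
    using that by (intro bexI[of _ "\<lambda>i\<in>{..<m}. b"]) (auto simp: wpow_V_def split: if_splits)
  have rigid: "coord_rigid V m {T, wpow_V V m}" using T(4) unfolding coord_rigid_def by blast
  have "m > 0" using step by simp
  obtain T' where "T' \<subseteq> wpow_V V (Suc m)" "T' \<noteq> {}" "T' \<noteq> wpow_V V (Suc m)" "coord_rigid V (Suc m) {T'}"
    by (rule coord_rigid_step[OF fin card \<open>m > 0\<close> T(1) subset_refl T(2) card_T slices rigid])
  then show ?case by blast
qed

subsection \<open>The coloring\<close>

theorem mainTheorem6:
  fixes V :: "'a set" and E :: "'a \<Rightarrow> 'a \<Rightarrow> bool"
  assumes "graph V E" and "finite V" and "loopless V E"
    and "connected_graph V E" and "\<not> bipartite V E" and "R_thin V E"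
    and "card V \<ge> 3" and "prime_graph V E"
    and "\<exists>c j. proper_coloring V E c (chromatic_number V E) \<and>
           (\<forall>f. automorphism V E f \<and> (\<forall>v\<in>{v\<in>V. c v = j}. f v = v) \<longrightarrow> (\<forall>v\<in>V. f v = v))"
    and "n \<ge> 4"
  shows "distinguishing_chromatic_number (wpow_V V n) (wpow_E E n) \<le> chromatic_number V E + 1"
proof -
  interpret thin_graph V E by unfold_locales (rule assms)+
  define \<chi> where "\<chi> = chromatic_number V E"
  define m where "m = n - 1"
  have n: "n = Suc m" and m: "m \<ge> 3" using assms(10) by (auto simp: m_def)
  obtain c j0 where c: "proper_coloring V E c \<chi>"
    and j0: "\<And>f. automorphism V E f \<Longrightarrow> \<forall>v\<in>{v\<in>V. c v = j0}. f v = v \<Longrightarrow> \<forall>v\<in>V. f v = v"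
    using assms(9) unfolding \<chi>_def by blast
  have cV: "c v < \<chi>" if "v \<in> V" for v using c that by (auto simp: proper_coloring_def)
  have cE: "c u \<noteq> c v" if "E u v" for u v
    using c that edge_V[OF that] by (auto simp: proper_coloring_def)
  have "V \<noteq> {}" using assms(7) by auto
  then obtain v where v: "v \<in> V" by auto
  \<comment> \<open>The given class may be empty. Then there is no nontrivial automorphism at all,
    and the class of any vertex works.\<close>
  obtain j where ne: "{v\<in>V. c v = j} \<noteq> {}"
    and j: "\<And>f. automorphism V E f \<Longrightarrow> \<forall>v\<in>{v\<in>V. c v = j}. f v = v \<Longrightarrow> \<forall>v\<in>V. f v = v"
  proof (cases "{v\<in>V. c v = j0} = {}")
    case True
    then have "\<forall>v\<in>V. f v = v" if "automorphism V E f" for f using j0[OF that] by blast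
    then show ?thesis using that[of "c v"] v by blast
  next
    case False
    then show ?thesis using that[of j0] j0 by blast
  qed
  define C where "C = {v\<in>V. c v = j}"
  obtain v1 where v1: "v1 \<in> C" using ne by (auto simp: C_def)
  obtain T where T: "T \<subseteq> wpow_V V m" "coord_rigid V m {T}"
    using ex_coord_rigid_set[OF finite_V assms(7) m] by blast
  obtain U where U: "\<And>a. U a \<subseteq> wpow_V V m" "\<And>a. a \<in> {v1} \<Longrightarrow> U a = T" "inj_on (\<lambda>a. card (U a)) V"
  proof (rule family_with_distinct_cards[OF finite_V finite_wpow[of m], of "{v1}" "\<lambda>_. T"])
    show "card V \<le> card (wpow_V V m) + 1" using card_le_card_wpow[OF finite_V, of m] m by simp
  qed (use v1 T in \<open>auto simp: C_def\<close>)
  \<comment> \<open>Only the fibres over the color class are kept, so recolored vertices have last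
    coordinates in an independent set and may share the new color \<open>\<chi>\<close>.\<close>
  define U' where "U' a = (if a \<in> C then U a else {})" for a
  define S where "S = fibred V m U'"
  have SC: "x m \<in> C" if "x \<in> S" for x using that by (auto simp: S_def fibred_def U'_def split: if_splits)
  define k where "k x = (if x \<in> S then \<chi> else c (x m))" for x
  have xm: "x m \<in> V" if "x \<in> wpow_V V n" for x using wpow_nth[OF that] n by simp
  have "proper_coloring (wpow_V V n) (wpow_E E n) k (\<chi> + 1)"
    unfolding proper_coloring_def
  proof (intro conjI ballI impI)
    fix x assume "x \<in> wpow_V V n"
    then show "k x < \<chi> + 1" using cV[OF xm] by (auto simp: k_def less_Suc_eq)
  next
    fix x y assume xy: "x \<in> wpow_V V n" "y \<in> wpow_V V n" "wpow_E E n x y"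
    then have "c (x m) \<noteq> c (y m)" using cE n by (auto simp: wpow_E_def)
    then show "k x \<noteq> k y" using SC[of x] SC[of y] cV[OF xm[OF xy(1)]] cV[OF xm[OF xy(2)]]
      by (auto simp: k_def C_def)
  qed
  moreover have "distinguishing (wpow_V V n) (wpow_E E n) k"
    unfolding distinguishing_def
  proof (intro allI impI ballI, elim conjE)
    fix f x
    assume aut: "automorphism (wpow_V V n) (wpow_E E n) f" and x: "x \<in> wpow_V V n"
      and kf: "\<forall>x\<in>wpow_V V n. k (f x) = k x"
    have "2 \<le> card V" using assms(7) by simp
    then obtain \<pi> \<alpha> where \<pi>: "bij_betw \<pi> {..<n} {..<n}" and \<alpha>: "\<And>i. i < n \<Longrightarrow> automorphism V E (\<alpha> i)"
      and f: "\<And>x i. x \<in> wpow_V V n \<Longrightarrow> i < n \<Longrightarrow> f x i = \<alpha> i (x (\<pi> i))"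
      using automorphism_wpow_coordinatewise[OF aut assms(8)] by blast
    have cp: "coord_perm V (Suc m) \<pi> \<alpha>"
      using \<pi> \<alpha> n by (auto simp: coord_perm_def automorphism_def graph_iso_def)
    have fW: "f x \<in> wpow_V V n" if "x \<in> wpow_V V n" for x by (rule aut_in[OF aut that])
    have f_eq: "coord_map (Suc m) \<pi> \<alpha> x = f x" if x: "x \<in> wpow_V V n" for x
    proof (rule wpow_ext[OF _ fW[OF x]])
      show "coord_map (Suc m) \<pi> \<alpha> x \<in> wpow_V V n" using coord_map_in[OF cp] x n by simp
      show "coord_map (Suc m) \<pi> \<alpha> x i = f x i" if "i < n" for i
        using f[OF x that] that n by (simp add: coord_map_def)
    qed
    have S_iff: "x \<in> S \<longleftrightarrow> k x = \<chi>" if "x \<in> wpow_V V n" for x using cV[OF xm[OF that]] by (auto simp: k_def)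
    have S: "f x \<in> S \<longleftrightarrow> x \<in> S" if "x \<in> wpow_V V n" for x
      using S_iff[OF that] S_iff[OF fW[OF that]] kf that by simp
    \<comment> \<open>The original color of the last coordinate is not lost by recoloring: on
      \<open>S\<close> it is always \<open>j\<close>.\<close>
    have cf: "c (\<alpha> m (x (\<pi> m))) = c (x m)" if x: "x \<in> wpow_V V n" for x
    proof -
      have "c (f x m) = c (x m)"
      proof (cases "x \<in> S")
        case True
        then show ?thesis using S[OF x] SC[of x] SC[of "f x"] by (simp add: C_def)
      next
        case False
        then show ?thesis using S[OF x] kf[rule_format, OF x] by (simp add: k_def)
      qed
      then show ?thesis using f[OF x, of m] n by simp
    qed
    have \<pi>m: "\<pi> m = m"
    proof (rule ccontr)
      assume ne: "\<pi> m \<noteq> m"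
      \<comment> \<open>If the last coordinate of the image did not depend on that of the vertex,
        changing the latter from \<open>v\<close> to its neighbor \<open>b\<close> would keep its
        color.\<close>
      obtain b where b: "E v b" using ex_neighbor[OF v] by blast
      define z where "z = (\<lambda>i\<in>{..<n}. v)"
      have z: "z \<in> wpow_V V n" using v by (auto simp: z_def wpow_V_def split: if_splits)
      have "z(m := b) \<in> wpow_V V n" using z edge_V[OF b] n by (intro wpow_upd) auto
      from cf[OF this] cf[OF z] have "c b = c v" using ne n by (simp add: z_def)
      then show False using cE[OF b] by simp
    qed
    have c\<alpha>: "c (\<alpha> m a) = c a" if "a \<in> V" for a
      using cf[of "\<lambda>i\<in>{..<n}. a"] that \<pi>m n by (auto simp: wpow_V_def split: if_splits)
    have \<alpha>C: "\<alpha> m a \<in> C" if "a \<in> C" for a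
      using c\<alpha>[of a] coord_permD(2)[OF cp, of m a] that by (auto simp: C_def)
    have pres: "coord_map (Suc m) \<pi> \<alpha> x \<in> fibred V m U' \<longleftrightarrow> x \<in> fibred V m U'"
      if "x \<in> wpow_V V (Suc m)" for x
      using S[of x] f_eq[of x] that n by (simp add: S_def)
    have CV: "C \<subseteq> V" by (auto simp: C_def)
    have U'V: "U' a \<subseteq> wpow_V V m" for a using U(1) by (simp add: U'_def)
    have inj: "inj_on (\<lambda>a. card (U' a)) C"
      using inj_on_subset[OF U(3) CV] by (simp add: U'_def inj_on_def)
    have "T \<in> U' ` C" using U(2)[of v1] v1 by (auto simp: U'_def image_iff)
    then have rig: "coord_rigid V m (U' ` C)" using T(2) unfolding coord_rigid_def by blast
    have on_C: "\<alpha> m a = a" if "a \<in> C" for a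
      by (rule fibres_fixed(1)[OF finite_V cp \<pi>m _ _ CV _ inj rig that]) (use pres U'V \<alpha>C in auto)
    have "automorphism V E (\<alpha> m)" using \<alpha> n by simp
    \<comment> \<open>The distinct fibre sizes fix the class pointwise, and the hypothesis on the
      class extends this to all of \<open>V\<close>.\<close>
    then have last: "\<forall>a\<in>V. \<alpha> m a = a" by (rule j) (use on_C in \<open>auto simp: C_def\<close>)
    have init: "coord_map m \<pi> \<alpha> y = y" if "y \<in> wpow_V V m" for y
      by (rule fibres_fixed(2)[OF finite_V cp \<pi>m _ _ CV _ inj rig that]) (use pres U'V \<alpha>C in auto)
    have x': "x \<in> wpow_V V (Suc m)" using x n by simp
    have xr: "(restrict x {..<m})(m := x m) = x"
      by (rule wpow_ext[OF wpow_snoc[OF wpow_init[OF x'] xm[OF x]] x']) auto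
    have "coord_map (Suc m) \<pi> \<alpha> ((restrict x {..<m})(m := x m)) = (restrict x {..<m})(m := x m)"
      unfolding coord_map_snoc[OF cp \<pi>m wpow_init[OF x']] init[OF wpow_init[OF x']]
      using last xm[OF x] by simp
    then show "f x = x" using f_eq[OF x] xr by simp
  qed
  ultimately show ?thesis
    unfolding distinguishing_chromatic_number_def \<chi>_def[symmetric] by (intro Least_le) blast
qed

end
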